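(* Suppose that $p$ is a hyperbolic polynomial of degree $d$ in $n$ real variables, hyperbolic with respect to $e\in\mathbb{R}^n$, and let $\Lambda_+$ denote the associated hyperbolicity cone. Then $\mathrm{sp}_{\Lambda_+}(\epsilon)\le\lceil 4d/\epsilon^2\rceil$ for all $\epsilon\in(0,1)$.
   Context: Hyperbolic polynomials. A polynomial $p$ with real coefficients in $n$ variables, homogeneous of degree $d$, is hyperbolic with respect to $e\in\mathbb{R}^n$ if $p(e)>0$ and, for every fixed $x\in\mathbb{R}^n$, every root $t$ of $p(te-x)=0$ is real. The $d$ roots (with multiplicity) are the hyperbolic eigenvalues $\lambda_1^{(p,e)}(x)\ge\cdots\ge\lambda_d^{(p,e)}(x)$ of $x$. The hyperbolicity cone is $\Lambda_+=\Lambda_+(p,e)=\{x\in\mathbb{R}^n:\lambda_i^{(p,e)}(x)\ge0,\ i=1,\dots,d\}$, which is a closed convex cone. Sparsification function. For a closed convex cone $K$ and $x,y\in\mathrm{span}(K)$, write $x\preceq_K y$ if $y-x\in K$. A sparsification function for $K$ is a monotonically non-increasing upper semi-continuous function $\alpha:(0,1)\to\mathbb{R}$ such that for any $x_1,\dots,x_m\in K$ with $\sum_{i=1}^m x_i=e\in\mathrm{relint}(K)$ and any $0<\epsilon<1$, there exist $S\subseteq[m]$ with $|S|\le\alpha(\epsilon)$ and positive scalars $(\lambda_i)_{i\in S}$ such that $(1-\epsilon)e\preceq_K\sum_{i\in S}\lambda_i x_i\preceq_K(1+\epsilon)e$. Let $\mathcal{F}_K$ be the collection of all sparsification functions for $K$;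 the sparsification function of $K$ is $\mathrm{sp}_K(\epsilon)=\inf_{\alpha\in\mathcal{F}_K}\alpha(\epsilon)$, $\epsilon\in(0,1)$. *)

theory Defs
  imports
    "HOL-Analysis.Analysis"
    "HOL-Library.Poly_Mapping"
    "HOL-Computational_Algebra.Polynomial"
begin

text \<open>
  Polynomials in the variables indexed by \<open>'n\<close>: finitely supported maps from exponent vectors
  to coefficients.
\<close>
type_synonym ('n, 'a) mpolynomial = "('n \<Rightarrow>\<^sub>0 nat) \<Rightarrow>\<^sub>0 'a"

text \<open>
  Evaluation along a coefficient embedding \<open>\<phi>\<close>. Below it is used with the identity
  (real values), with the inclusion of the reals into the complex numbers, and with the inclusion
  of the constants into the univariate polynomials.
\<close>
definition mpoly_eval ::
    "('a::zero \<Rightarrow> 'b::comm_ring_1) \<Rightarrow> ('n::finite, 'a) mpolynomial \<Rightarrow> ('n \<Rightarrow> 'b) \<Rightarrow> 'b" where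
  "mpoly_eval \<phi> p v =
     (\<Sum>m\<in>Poly_Mapping.keys p.
        \<phi> (Poly_Mapping.lookup p m) * (\<Prod>i\<in>UNIV. v i ^ Poly_Mapping.lookup m i))"

definition homogeneous_of_degree :: "nat \<Rightarrow> ('n::finite, 'a::zero) mpolynomial \<Rightarrow> bool" where
  "homogeneous_of_degree d p \<longleftrightarrow>
     (\<forall>m\<in>Poly_Mapping.keys p. (\<Sum>i\<in>UNIV. Poly_Mapping.lookup m i) = d)"

text \<open>In the last conjunct, \<open>t\<close> ranges over the complex numbers.\<close>
definition hyperbolic :: "nat \<Rightarrow> ('n::finite, real) mpolynomial \<Rightarrow> real^'n \<Rightarrow> bool" where
  "hyperbolic d p e \<longleftrightarrow>
     homogeneous_of_degree d p \<and>
     mpoly_eval (\<lambda>a. a) p (\<lambda>i. e $ i) > 0 \<and>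
     (\<forall>x :: real^'n. \<forall>t :: complex.
        mpoly_eval complex_of_real p (\<lambda>i. t * complex_of_real (e $ i) - complex_of_real (x $ i)) = 0
          \<longrightarrow> t \<in> \<real>)"

text \<open>The polynomial \<open>p (t e - x)\<close> in the single variable \<open>t\<close>.\<close>
definition line_poly :: "('n::finite, real) mpolynomial \<Rightarrow> real^'n \<Rightarrow> real^'n \<Rightarrow> real poly" where
  "line_poly p e x = mpoly_eval (\<lambda>a. [:a:]) p (\<lambda>i. [:- (x $ i), e $ i:])"

text \<open>
  The roots of \<open>p (t e - x)\<close> with multiplicity, in non-increasing order. If \<open>p\<close> is hyperbolic
  of degree \<open>d\<close> with respect to \<open>e\<close>, this list has length \<open>d\<close>.
\<close>
definition hyp_eigenvalues :: "('n::finite, real) mpolynomial \<Rightarrow> real^'n \<Rightarrow> real^'n \<Rightarrow> real list" where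
  "hyp_eigenvalues p e x = rev (sorted_list_of_multiset (proots (line_poly p e x)))"

definition hyp_eigenvalue ::
    "('n::finite, real) mpolynomial \<Rightarrow> real^'n \<Rightarrow> nat \<Rightarrow> real^'n \<Rightarrow> real" where
  "hyp_eigenvalue p e i x = hyp_eigenvalues p e x ! (i - 1)"

definition hyperbolicity_cone ::
    "nat \<Rightarrow> ('n::finite, real) mpolynomial \<Rightarrow> real^'n \<Rightarrow> (real^'n) set" where
  "hyperbolicity_cone d p e = {x. \<forall>i\<in>{1..d}. hyp_eigenvalue p e i x \<ge> 0}"

definition cone_le :: "'a::euclidean_space set \<Rightarrow> 'a \<Rightarrow> 'a \<Rightarrow> bool" where
  "cone_le K x y \<longleftrightarrow> x \<in> span K \<and> y \<in> span K \<and> y - x \<in> K"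

definition upper_semicontinuous_on :: "'a::topological_space set \<Rightarrow> ('a \<Rightarrow> real) \<Rightarrow> bool" where
  "upper_semicontinuous_on A f \<longleftrightarrow>
     (\<forall>x\<in>A. \<forall>c. f x < c \<longrightarrow> (\<forall>\<^sub>F y in at x within A. f y < c))"

text \<open>A function on \<open>(0,1)\<close> is represented by a total function whose values elsewhere are irrelevant.\<close>
definition sparsification_function :: "'a::euclidean_space set \<Rightarrow> (real \<Rightarrow> real) \<Rightarrow> bool" where
  "sparsification_function K \<alpha> \<longleftrightarrow>
     antimono_on {0<..<1} \<alpha> \<and>
     upper_semicontinuous_on {0<..<1} \<alpha> \<and>
     (\<forall>(m :: nat) (x :: nat \<Rightarrow> 'a) e \<epsilon>.
        (\<forall>i\<in>{1..m}. x i \<in> K) \<and> (\<Sum>i\<in>{1..m}. x i) = e \<and> e \<in> rel_interior K \<and> 0 < \<epsilon> \<and> \<epsilon> < 1 \<longrightarrow>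
        (\<exists>S (l :: nat \<Rightarrow> real).
           S \<subseteq> {1..m} \<and> real (card S) \<le> \<alpha> \<epsilon> \<and> (\<forall>i\<in>S. l i > 0) \<and>
           cone_le K ((1 - \<epsilon>) *\<^sub>R e) (\<Sum>i\<in>S. l i *\<^sub>R x i) \<and>
           cone_le K (\<Sum>i\<in>S. l i *\<^sub>R x i) ((1 + \<epsilon>) *\<^sub>R e)))"

text \<open>
  The infimum is taken in the extended reals, so that it is \<open>\<infinity>\<close> (and not an arbitrary real
  number) if \<open>K\<close> has no sparsification function.
\<close>
definition sp :: "'a::euclidean_space set \<Rightarrow> real \<Rightarrow> ereal" where
  "sp K \<epsilon> = (INF \<alpha>\<in>{\<alpha>. sparsification_function K \<alpha>}. ereal (\<alpha> \<epsilon>))"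

end

theory Submission
  imports Defs "HOL-Computational_Algebra.Fundamental_Theorem_Algebra"
begin

text \<open>
  The barrier method of Batson, Spielman and Srivastava works with the barrier \<open>- ln h\<close> of the
  hyperbolicity cone in place of \<open>- ln det\<close>. Garding's theory allows us to take \<open>e = \<Sum>i. x i\<close> as the
  direction of hyperbolicity. What replaces the Sherman--Morrison formula is the following. For
  \<open>x\<close>, \<open>b\<close> in the open cone, the rational function \<open>s \<mapsto> (D_e h / h) (b + s x)\<close> maps the upper half
  plane to the lower one, because \<open>h\<close> does not vanish at points whose imaginary part lies in the
  cone. Hence it equals \<open>\<Sum>i. c i / (s + a i)\<close> with \<open>c i \<ge> 0\<close> and \<open>a i > 0\<close>, while
  \<open>(D_x h / h) b = \<Sum>i. 1 / a i =: T\<close>; comparing term by term, its value at \<open>s\<close> is at most its first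
  order expansion at \<open>0\<close> with the linear term divided by \<open>1 + s T\<close>. This bound is linear in \<open>x\<close> up
  to the factor \<open>1 / (1 + s T)\<close>, so that it can be averaged over the \<open>x i\<close>.
\<close>

section \<open>Complex zeros of homogeneous polynomials\<close>

text \<open>The barrier is kept on both sides of the running sum \<open>A\<close>, at
  \<open>u e - A\<close> and at \<open>A - l e\<close>, so the first order bound is needed for steps
  \<open>s\<close> of either sign: adding \<open>t x\<close> is \<open>s = t\<close> for the lower
  barrier and \<open>s = - t\<close> for the upper one. The given vectors may lie on the boundary of
  the cone, where \<open>h\<close> can vanish and \<open>x\<close> is no direction of hyperbolicity;
  each estimate is therefore proved for \<open>x\<close> in the open cone and carried to the
  boundary by way of \<open>x + \<eta> e\<close> with \<eta> tending to 0. The constant 4: after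
  \<open>N = d s^2\<close> steps the upper and the lower barrier have the ratio
  \<open>((s + 1) / (s - 1))^2\<close>, and for s > 1 this is at most
  \<open>(1 + \<epsilon>) / (1 - \<epsilon>)\<close> exactly when
  \<open>2 s \<le> \<epsilon> (s^2 + 1)\<close>. The choice \<open>s = 2 / \<epsilon>\<close>
  satisfies this with \<epsilon> to spare. That room pays for rounding
  \<open>4 d / \<epsilon>^2\<close> down.\<close>

definition cvec :: "real^'n \<Rightarrow> complex^'n" where
  "cvec x = (\<chi> i. complex_of_real (x $ i))"

lemma cvec_nth [simp]: "cvec x $ i = complex_of_real (x $ i)"
  by (simp add: cvec_def)

lemma cvec_add: "cvec (x + y) = cvec x + cvec y"
  by (simp add: vec_eq_iff)

lemma cvec_scaleR: "cvec (r *\<^sub>R x) = complex_of_real r *s cvec x"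
  by (simp add: vec_eq_iff)

lemma norm_vector_scalar_mult: "norm (c *s z) = norm (c::complex) * norm z"
  by (simp add: norm_vec_def norm_mult L2_set_right_distrib)

lemma continuous_on_vector_scalar_mult [continuous_intros]:
  fixes f :: "'a::topological_space \<Rightarrow> complex" and g :: "'a \<Rightarrow> complex^'n"
  assumes "continuous_on S f" "continuous_on S g"
  shows "continuous_on S (\<lambda>x. f x *s g x)"
  unfolding vector_scalar_mult_def
  by (intro continuous_intros continuous_on_vec_lambda assms continuous_on_component)

lemma continuous_on_cvec [continuous_intros]:
  assumes "continuous_on S g"
  shows "continuous_on S (\<lambda>x. cvec (g x))"
  unfolding cvec_def
  by (intro continuous_intros continuous_on_vec_lambda assms continuous_on_component)

lemma halfplane_frontier:
  fixes f :: "complex \<Rightarrow> real"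
  assumes "continuous_on UNIV f" "t \<in> frontier {t. 0 < f t}"
  shows "f t = 0"
proof -
  have "open {t. 0 < f t}" "closed {t. 0 \<le> f t}"
    using assms(1) by (auto intro!: open_Collect_less closed_Collect_le continuous_intros)
  then have "interior {t. 0 < f t} = {t. 0 < f t}" "closure {t. 0 < f t} \<subseteq> {t. 0 \<le> f t}"
    using closure_minimal[of "{t. 0 < f t}" "{t. 0 \<le> f t}"] by (simp_all add: interior_open Collect_mono less_imp_le)
  with assms(2) show ?thesis
    by (auto simp: frontier_def)
qed

lemma open_shrink:
  fixes a e :: "'a::real_normed_vector"
  assumes "open S" "a \<in> S"
  obtains c where "0 < c" "a - c *\<^sub>R e \<in> S"
proof -
  have "((\<lambda>c. a - c *\<^sub>R e) \<longlongrightarrow> a - 0 *\<^sub>R e) (at_right 0)"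
    by (intro tendsto_intros)
  then have "\<forall>\<^sub>F c in at_right 0. a - c *\<^sub>R e \<in> S"
    using assms by (intro topological_tendstoD) auto
  then have "\<forall>\<^sub>F c in at_right (0::real). 0 < c \<and> a - c *\<^sub>R e \<in> S"
    by (rule eventually_conj[OF eventually_at_right_less])
  then show thesis
    using that by (metis (mono_tags, lifting) eventually_happens trivial_limit_at_right_real)
qed

text \<open>\<open>H\<close> is the complexification of \<open>h\<close>, and \<open>K v\<close>,
  \<open>k v\<close> are the derivatives of \<open>H\<close>, \<open>h\<close> in the real direction
  \<open>v\<close>. Polynomials enter only through their restrictions to complex lines. The strict
  degree bound in \<open>K_line\<close> makes the quotient of \<open>K\<close> by \<open>H\<close> a
  proper fraction on lines; it also forces d > 0.\<close>

locale homogeneous_form =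
  fixes H :: "complex^'n::finite \<Rightarrow> complex" and h :: "real^'n \<Rightarrow> real"
    and K :: "real^'n \<Rightarrow> complex^'n \<Rightarrow> complex" and k :: "real^'n \<Rightarrow> real^'n \<Rightarrow> real"
    and d :: nat
  assumes homogeneous: "H (c *s z) = c ^ d * H z"
    and line: "\<exists>P. degree P \<le> d \<and> (\<forall>t. H (z + t *s w) = poly P t)"
    and continuous: "continuous_on UNIV H"
    and H_cvec: "H (cvec x) = complex_of_real (h x)"
    and h_differentiable: "h differentiable (at x)"
    and H_derivative: "((\<lambda>r. H (z + r *s cvec v)) has_field_derivative K v z) (at 0)"
    and K_line: "\<exists>P. degree P < d \<and> (\<forall>t. K v (z + t *s w) = poly P t)"
    and K_cvec: "K v (cvec x) = complex_of_real (k v x)"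
    and k_differentiable: "k v differentiable (at x)"
begin

lemma continuous_on_H [continuous_intros]:
  assumes "continuous_on S f"
  shows "continuous_on S (\<lambda>x. H (f x))"
  using continuous_on_compose2[OF continuous assms] by simp

lemma H_rescale:
  assumes "t \<noteq> 0"
  shows "H (z + t *s w) = t ^ d * H (w + inverse t *s z)"
proof -
  have "z + t *s w = t *s (w + inverse t *s z)"
    using assms by (simp add: vec_eq_iff distrib_left flip: mult.assoc)
  then show ?thesis
    by (simp only: homogeneous)
qed

text \<open>By \<open>H_rescale\<close> the polynomial of the line through \<open>z\<close> in
  direction \<open>D\<close> is, up to degree d, the reversal of the polynomial of the line through
  \<open>D\<close> in direction \<open>z\<close>. Its coefficient at t^d is therefore the value of
  the latter at 0, namely \<open>H D\<close>, so the degree is exactly d. The rescaling is available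
  only for nonzero t, but two polynomials that agree at all nonzero t are equal.\<close>

lemma factorization:
  assumes "H D \<noteq> 0"
  obtains \<rho> where "\<And>t. H (z + t *s D) = H D * (\<Prod>i<d. t - \<rho> i)"
proof -
  obtain P where P: "degree P \<le> d" "\<And>t. H (z + t *s D) = poly P t"
    using line by metis
  obtain Q where Q: "degree Q \<le> d" "\<And>t. H (D + t *s z) = poly Q t"
    using line by metis
  define Q' where "Q' = (\<Sum>i\<le>d. monom (coeff Q i) (d - i))"
  have eq: "poly P t = poly Q' t" if "t \<noteq> 0" for t
  proof -
    have "poly P t = t ^ d * poly Q (inverse t)"
      using H_rescale[OF that] by (simp flip: P(2) Q(2))
    also have "\<dots> = (\<Sum>i\<le>d. t ^ d * (coeff Q i * inverse t ^ i))"
      unfolding poly_altdef sum_distrib_left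
      by (intro sum.mono_neutral_left) (use Q(1) in \<open>auto simp: coeff_eq_0\<close>)
    also have "\<dots> = poly Q' t"
      unfolding Q'_def poly_sum poly_monom
      by (intro sum.cong refl) (use that in \<open>auto simp: power_diff field_simps\<close>)
    finally show ?thesis .
  qed
  have "P = Q'"
  proof (rule ccontr)
    assume "P \<noteq> Q'"
    then have "finite {t. poly (P - Q') t = 0}"
      by (intro poly_roots_finite) auto
    moreover have "- {0} \<subseteq> {t. poly (P - Q') t = 0}"
      using eq by auto
    ultimately have "finite (- {0::complex})"
      by (rule rev_finite_subset)
    then show False
      by (simp add: infinite_UNIV_char_0)
  qed
  have "coeff Q' d = (\<Sum>i\<le>d. if i = 0 then coeff Q i else 0)"
    unfolding Q'_def coeff_sum coeff_monom by (intro sum.cong) auto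
  also have "\<dots> = H D"
    using Q(2)[of 0] by (simp add: poly_0_coeff_0)
  finally have lc: "coeff P d = H D"
    by (simp add: \<open>P = Q'\<close>)
  with assms P(1) have deg: "degree P = d"
    by (metis le_antisym le_degree)
  from complex_poly_decompose'[of P] obtain root where
    root: "smult (lead_coeff P) (\<Prod>i<degree P. [:- root i, 1:]) = P" .
  have "H (z + t *s D) = H D * (\<Prod>i<d. t - root i)" for t
    unfolding P(2) using arg_cong[OF root, of "\<lambda>p. poly p t"]
    by (simp add: deg lc poly_prod)
  then show thesis
    by (rule that)
qed

text \<open>
  The lower bound \<open>|H D| r^d\<close> for the value at a point
  at distance \<open>r\<close> from all zeros serves as a substitute for Hurwitz's theorem.
\<close>
lemma zero_free_homotopy:
  fixes Z :: "real \<Rightarrow> complex^'n"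
  assumes D: "H D \<noteq> 0" and Z: "continuous_on {0..1} Z" and \<Omega>: "open \<Omega>"
    and frontier: "\<And>\<theta> t. \<theta> \<in> {0..1} \<Longrightarrow> t \<in> frontier \<Omega> \<Longrightarrow> H (Z \<theta> + t *s D) \<noteq> 0"
    and start: "\<And>t. t \<in> \<Omega> \<Longrightarrow> H (Z 0 + t *s D) \<noteq> 0"
    and "t \<in> \<Omega>"
  shows "H (Z 1 + t *s D) \<noteq> 0"
proof -
  \<comment> \<open>The parameters at which a zero lies in \<Omega>. This set turns out to be both
    closed and open in the connected interval, and it misses 0.\<close>
  define S where "S = {\<theta>\<in>{0..1}. \<exists>t\<in>\<Omega>. H (Z \<theta> + t *s D) = 0}"
  obtain \<delta> where "\<delta> > 0" and \<delta>: "\<And>z. dist D z < \<delta> \<Longrightarrow> H z \<noteq> 0"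
  proof -
    have "isCont H D"
      using continuous by (simp add: continuous_on_eq_continuous_at)
    then have "\<forall>\<^sub>F z in nhds D. H z \<noteq> 0"
      using D by (intro tendsto_imp_eventually_ne) (simp_all add: isCont_def tendsto_at_iff_tendsto_nhds)
    then show thesis
      using that by (auto simp: eventually_nhds_metric dist_commute)
  qed
  obtain B where "B > 0" and B: "\<And>\<theta>. \<theta> \<in> {0..1} \<Longrightarrow> norm (Z \<theta>) \<le> B"
    using compact_imp_bounded[OF compact_continuous_image[OF Z compact_Icc]]
    by (auto simp: bounded_pos)
  \<comment> \<open>Dividing by a large t moves the point into the ball around \<open>D\<close>
    where \<open>H\<close> does not vanish. Hence all zeros lie in one disc for all \<theta>, which
    supplies the compactness for closedness.\<close>
  have root_bound: "norm t \<le> B / \<delta>" if "\<theta> \<in> {0..1}" "H (Z \<theta> + t *s D) = 0" for \<theta> t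
  proof (rule ccontr)
    assume *: "\<not> ?thesis"
    moreover have "B / \<delta> > 0"
      using \<open>B > 0\<close> \<open>\<delta> > 0\<close> by simp
    ultimately have "t \<noteq> 0"
      by auto
    have "norm (inverse t *s Z \<theta>) = norm (Z \<theta>) / norm t"
      by (simp only: norm_vector_scalar_mult norm_inverse divide_inverse mult.commute)
    also have "\<dots> \<le> B / norm t"
      by (intro divide_right_mono B that) simp
    also have "\<dots> < \<delta>"
      using * \<open>t \<noteq> 0\<close> \<open>\<delta> > 0\<close> by (simp add: field_simps)
    finally have "H (D + inverse t *s Z \<theta>) \<noteq> 0"
      by (intro \<delta>) (simp add: dist_norm)
    then show False
      using that(2) H_rescale[OF \<open>t \<noteq> 0\<close>] \<open>t \<noteq> 0\<close> by simp
  qed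
  have Z2: "continuous_on ({0..1} \<times> A) (\<lambda>x. Z (fst x))" for A :: "complex set"
    by (intro continuous_on_compose2[OF Z] continuous_intros) auto
  define T where "T = {x \<in> {0..1} \<times> (cball 0 (B / \<delta>) \<inter> closure \<Omega>). H (Z (fst x) + snd x *s D) = 0}"
  have "compact T"
  proof -
    have "compact ({0..1::real} \<times> (cball 0 (B / \<delta>) \<inter> closure \<Omega>))"
      by (intro compact_Times compact_Int_closed compact_Icc compact_cball closed_closure)
    moreover have "continuous_on ({0..1} \<times> (cball 0 (B / \<delta>) \<inter> closure \<Omega>)) (\<lambda>x. H (Z (fst x) + snd x *s D))"
      by (intro continuous_intros Z2)
    ultimately show ?thesis
      unfolding T_def by (intro closedin_compact[OF _ continuous_closedin_preimage_constant])
  qed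
  \<comment> \<open>Passing to the closure of \<Omega> adds no zeros, since the frontier has
    none.\<close>
  moreover have "S = fst ` T"
  proof
    show "S \<subseteq> fst ` T"
    proof
      fix \<theta> assume "\<theta> \<in> S"
      then obtain t where "\<theta> \<in> {0..1}" "t \<in> \<Omega>" "H (Z \<theta> + t *s D) = 0"
        by (auto simp: S_def)
      then have "(\<theta>, t) \<in> T"
        using root_bound closure_subset by (auto simp: T_def)
      then show "\<theta> \<in> fst ` T"
        by force
    qed
    show "fst ` T \<subseteq> S"
    proof
      fix \<theta> assume "\<theta> \<in> fst ` T"
      then obtain t where t: "\<theta> \<in> {0..1}" "t \<in> closure \<Omega>" "H (Z \<theta> + t *s D) = 0"
        by (auto simp: T_def)
      then have "t \<notin> frontier \<Omega>"
        using frontier by blast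
      then have "t \<in> \<Omega>"
        using t(2) \<Omega> by (simp add: frontier_def interior_open)
      with t show "\<theta> \<in> S"
        by (auto simp: S_def)
    qed
  qed
  ultimately have "closed S"
    by (simp add: compact_imp_closed compact_continuous_image continuous_on_fst continuous_on_id)
  moreover have "S \<subseteq> {0..1}"
    by (auto simp: S_def)
  ultimately have closed: "closedin (top_of_set {0..1}) S"
    by (simp add: closed_subset)
  have "openin (top_of_set {0..1}) S"
    unfolding openin_contains_ball
  proof (intro conjI ballI)
    fix \<theta> assume "\<theta> \<in> S"
    then obtain t where t: "\<theta> \<in> {0..1}" "t \<in> \<Omega>" "H (Z \<theta> + t *s D) = 0"
      by (auto simp: S_def)
    obtain r where "r > 0" and r: "ball t r \<subseteq> \<Omega>"
      using \<Omega> t(2) by (meson open_contains_ball)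
    have "continuous_on {0..1} (\<lambda>\<theta>. norm (H (Z \<theta> + t *s D)))"
      by (intro continuous_intros Z)
    moreover have "0 < norm (H D) * r ^ d"
      using D \<open>r > 0\<close> by simp
    ultimately obtain \<eta> where "\<eta> > 0"
      and "\<And>\<theta>'. \<theta>' \<in> {0..1} \<Longrightarrow> dist \<theta>' \<theta> < \<eta> \<Longrightarrow>
        dist (norm (H (Z \<theta>' + t *s D))) (norm (H (Z \<theta> + t *s D))) < norm (H D) * r ^ d"
      unfolding continuous_on_iff using t(1) by blast
    then have \<eta>: "\<And>\<theta>'. \<theta>' \<in> {0..1} \<Longrightarrow> dist \<theta>' \<theta> < \<eta> \<Longrightarrow> norm (H (Z \<theta>' + t *s D)) < norm (H D) * r ^ d"
      using t(3) by simp
    have "\<theta>' \<in> S" if \<theta>': "\<theta>' \<in> {0..1}" "dist \<theta>' \<theta> < \<eta>" for \<theta>'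
    proof (rule ccontr)
      assume "\<theta>' \<notin> S"
      then have no: "H (Z \<theta>' + s *s D) \<noteq> 0" if "s \<in> \<Omega>" for s
        using \<theta>' that by (auto simp: S_def)
      obtain \<rho> where \<rho>: "\<And>t. H (Z \<theta>' + t *s D) = H D * (\<Prod>i<d. t - \<rho> i)"
        using factorization[OF D] by metis
      have "r \<le> norm (t - \<rho> i)" if "i < d" for i
      proof -
        have "\<rho> i \<notin> \<Omega>"
          using no[of "\<rho> i"] that unfolding \<rho> by auto
        with r show ?thesis
          by (force simp: dist_norm)
      qed
      then have "r ^ d \<le> (\<Prod>i<d. norm (t - \<rho> i))"
        using prod_mono[of "{..<d}" "\<lambda>_. r" "\<lambda>i. norm (t - \<rho> i)"] \<open>r > 0\<close> by simp
      then show False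
        using \<eta>[OF \<theta>'] D unfolding \<rho> by (simp add: norm_mult flip: prod_norm)
    qed
    then show "\<exists>e>0. ball \<theta> e \<inter> {0..1} \<subseteq> S"
      using \<open>\<eta> > 0\<close> by (intro exI[of _ \<eta>]) (auto simp: dist_commute)
  qed (auto simp: S_def)
  with closed have "S = {} \<or> S = {0..1}"
    using connected_Icc[of 0 "1::real"] unfolding connected_clopen by blast
  moreover have "0 \<notin> S"
    using start by (auto simp: S_def)
  ultimately have "1 \<notin> S"
    by auto
  with \<open>t \<in> \<Omega>\<close> show ?thesis
    by (auto simp: S_def)
qed


section \<open>Hyperbolicity cones\<close>

text \<open>Every point of the open cone has to qualify as a direction, so only
  \<open>h e \<noteq> 0\<close> is asked and no sign has to be tracked. Since x is arbitrary,
  \<open>x + t e\<close> serves as well as \<open>t e - x\<close>.\<close>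

definition hyperbolic_along :: "real^'n \<Rightarrow> bool" where
  "hyperbolic_along e \<longleftrightarrow> h e \<noteq> 0 \<and> (\<forall>x t. Im t \<noteq> 0 \<longrightarrow> H (cvec x + t *s cvec e) \<noteq> 0)"

text \<open>When \<open>h (x + t e)\<close> is \<open>h e\<close> times the product of the factors
  \<open>t + \<mu> i\<close>, membership means that all eigenvalues \<open>\<mu> i\<close> of
  \<open>x\<close> are positive, and for \<open>closed_cone\<close> that they are nonnegative.
  Stating it as the absence of zeros on a ray avoids choosing the roots.\<close>

definition open_cone :: "real^'n \<Rightarrow> (real^'n) set" where
  "open_cone e = {x. \<forall>t\<ge>0. h (x + t *\<^sub>R e) \<noteq> 0}"

definition closed_cone :: "real^'n \<Rightarrow> (real^'n) set" where
  "closed_cone e = {x. \<forall>t>0. h (x + t *\<^sub>R e) \<noteq> 0}"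

section \<open>Garding's theorem: no zeros at points with imaginary part in the open cone\<close>

lemma H_cvec_line: "H (cvec x + complex_of_real t *s cvec y) = complex_of_real (h (x + t *\<^sub>R y))"
  by (simp add: cvec_add cvec_scaleR flip: H_cvec)

lemma h_scaleR: "h (r *\<^sub>R x) = r ^ d * h x"
proof -
  have "complex_of_real (h (r *\<^sub>R x)) = complex_of_real (r ^ d * h x)"
    by (simp add: cvec_scaleR homogeneous flip: H_cvec)
  then show ?thesis
    by (simp only: of_real_eq_iff)
qed

lemma open_cone_nonzero: "x \<in> open_cone e \<Longrightarrow> h x \<noteq> 0"
  by (auto simp: open_cone_def dest: spec[of _ 0])

text \<open>The real part \<open>y\<close> is deformed to 0. For real t the point is real except for
  the term \<open>i \<alpha> e\<close>, and hyperbolicity along \<open>e\<close> excludes a zero, so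
  none crosses the real axis. At the start only \<open>e\<close> and \<open>a\<close> remain: after
  division by t the multiplier of \<open>e\<close> is \<open>i \<alpha> / t\<close>, which if real
  is positive because Im t > 0, and \<open>a\<close> lies in the open cone.\<close>

lemma complex_shift_nonzero:
  assumes e: "hyperbolic_along e" and a: "a \<in> open_cone e" and "0 < \<alpha>" "0 < Im t"
  shows "H (cvec y + (\<i> * complex_of_real \<alpha>) *s cvec e + t *s cvec a) \<noteq> 0"
proof -
  define \<Omega> where "\<Omega> = {t. 0 < Im t}"
  define Z where "Z \<theta> = cvec (\<theta> *\<^sub>R y) + (\<i> * complex_of_real \<alpha>) *s cvec e" for \<theta>
  have "H (Z 1 + t *s cvec a) \<noteq> 0"
  proof (rule zero_free_homotopy)
    show "H (cvec a) \<noteq> 0"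
      using open_cone_nonzero[OF a] by (simp add: H_cvec)
    show "continuous_on {0..1} Z"
      unfolding Z_def by (intro continuous_intros)
    show "open \<Omega>"
      unfolding \<Omega>_def by (intro open_Collect_less continuous_intros)
    show "t \<in> \<Omega>"
      using \<open>0 < Im t\<close> by (simp add: \<Omega>_def)
  next
    fix \<theta> :: real and t assume "t \<in> frontier \<Omega>"
    then have "Im t = 0"
      unfolding \<Omega>_def by (intro halfplane_frontier[of Im]) (auto intro!: continuous_intros)
    then have t: "t = complex_of_real (Re t)"
      by (simp add: complex_eq_iff)
    have "Z \<theta> + t *s cvec a = cvec (\<theta> *\<^sub>R y + Re t *\<^sub>R a) + (\<i> * complex_of_real \<alpha>) *s cvec e"
      unfolding Z_def cvec_add cvec_scaleR[of "Re t"] by (subst t) simp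
    then show "H (Z \<theta> + t *s cvec a) \<noteq> 0"
      using e \<open>0 < \<alpha>\<close> by (simp add: hyperbolic_along_def)
  next
    fix t assume "t \<in> \<Omega>"
    then have t: "0 < Im t" "t \<noteq> 0"
      by (auto simp: \<Omega>_def)
    define u where "u = inverse t * (\<i> * complex_of_real \<alpha>)"
    have "H (Z 0 + t *s cvec a) = t ^ d * H (cvec a + u *s cvec e)"
      unfolding Z_def u_def using t by (subst H_rescale) (simp_all add: cvec_scaleR[of 0, simplified])
    moreover have "H (cvec a + u *s cvec e) \<noteq> 0"
    proof (cases "Im u = 0")
      case True
      then have u: "u = complex_of_real (Re u)"
        by (simp add: complex_eq_iff)
      have "Re u \<ge> 0"
        using t \<open>0 < \<alpha>\<close> by (simp add: u_def)
      with a show ?thesis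
        by (subst u) (simp add: H_cvec_line open_cone_def)
    qed (use e in \<open>simp add: hyperbolic_along_def\<close>)
    ultimately show "H (Z 0 + t *s cvec a) \<noteq> 0"
      using t by simp
  qed
  then show ?thesis
    by (simp add: Z_def)
qed

text \<open>Let \<alpha> tend to 0 in \<open>complex_shift_nonzero\<close>. The limit cannot vanish:
  along direction \<open>a\<close> all zeros have imaginary part at most 0, so at t = i every factor
  has modulus at least 1, and the value is bounded below by the modulus of \<open>H (cvec a)\<close>
  uniformly in \<alpha>.\<close>

lemma stable:
  assumes e: "hyperbolic_along e" and a: "a \<in> open_cone e"
  shows "H (cvec y + \<i> *s cvec a) \<noteq> 0"
proof
  assume zero: "H (cvec y + \<i> *s cvec a) = 0"
  define f where "f \<alpha> = norm (H (cvec y + (\<i> * complex_of_real \<alpha>) *s cvec e + \<i> *s cvec a))" for \<alpha>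
  have ha: "H (cvec a) \<noteq> 0"
    using open_cone_nonzero[OF a] by (simp add: H_cvec)
  have bound: "norm (H (cvec a)) \<le> f \<alpha>" if "0 < \<alpha>" for \<alpha>
  proof -
    obtain \<rho> where \<rho>: "\<And>t. H (cvec y + (\<i> * complex_of_real \<alpha>) *s cvec e + t *s cvec a)
        = H (cvec a) * (\<Prod>i<d. t - \<rho> i)"
      using factorization[OF ha] by metis
    have "1 \<le> norm (\<i> - \<rho> i)" if "i < d" for i
    proof -
      have "H (cvec y + (\<i> * complex_of_real \<alpha>) *s cvec e + \<rho> i *s cvec a) = 0"
        unfolding \<rho> using that by auto
      with complex_shift_nonzero[OF e a \<open>0 < \<alpha>\<close>] have "Im (\<rho> i) \<le> 0"
        by (meson not_le)
      then have "1 \<le> \<bar>Im (\<i> - \<rho> i)\<bar>"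
        by simp
      also have "\<dots> \<le> norm (\<i> - \<rho> i)"
        by (rule abs_Im_le_cmod)
      finally show ?thesis .
    qed
    then have "1 \<le> (\<Prod>i<d. norm (\<i> - \<rho> i))"
      by (intro prod_ge_1) auto
    then show ?thesis
      unfolding f_def \<rho> using ha by (simp add: norm_mult flip: prod_norm)
  qed
  have "continuous_on UNIV f"
    unfolding f_def by (intro continuous_intros)
  then have "(f \<longlongrightarrow> f 0) (at_right 0)"
    by (metis UNIV_I continuous_on_eq_continuous_at continuous_within filterlim_at_split open_UNIV)
  moreover have "\<forall>\<^sub>F \<alpha> in at_right 0. norm (H (cvec a)) \<le> f \<alpha>"
    using eventually_at_right_less by eventually_elim (rule bound)
  ultimately have "norm (H (cvec a)) \<le> f 0"
    by (rule tendsto_lowerbound) simp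
  then show False
    using zero ha by (simp add: f_def)
qed

section \<open>Change of direction, convexity and openness of the open cone\<close>

lemma open_cone_scaleR:
  assumes "a \<in> open_cone e" "0 < r"
  shows "r *\<^sub>R a \<in> open_cone e"
proof -
  have "h (r *\<^sub>R a + t *\<^sub>R e) \<noteq> 0" if "t \<ge> 0" for t
  proof -
    have "r *\<^sub>R a + t *\<^sub>R e = r *\<^sub>R (a + (t / r) *\<^sub>R e)"
      using assms(2) by (simp add: algebra_simps)
    then show ?thesis
      using assms that by (simp add: h_scaleR open_cone_def)
  qed
  then show ?thesis
    by (simp add: open_cone_def)
qed

lemma hyperbolic_along_open_cone:
  assumes e: "hyperbolic_along e" and a: "a \<in> open_cone e"
  shows "hyperbolic_along a"
proof -
  have pos: "H (cvec x + t *s cvec a) \<noteq> 0" if "0 < Im t" for x t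
  proof -
    have "cvec x + t *s cvec a = cvec (x + Re t *\<^sub>R a) + \<i> *s cvec (Im t *\<^sub>R a)"
      by (simp add: vec_eq_iff complex_eq_iff)
    then show ?thesis
      using stable[OF e open_cone_scaleR[OF a that]] by simp
  qed
  have "H (cvec x + t *s cvec a) \<noteq> 0" if "Im t \<noteq> 0" for x t
  proof (cases "0 < Im t")
    case False
    with that have "0 < Im (- t)"
      by simp
    moreover have "cvec x + t *s cvec a = (-1) *s (cvec (- x) + (- t) *s cvec a)"
      by (simp add: vec_eq_iff)
    ultimately show ?thesis
      using pos[of "- t" "- x"] by (simp only: homogeneous) simp
  qed (use pos in simp)
  then show ?thesis
    using open_cone_nonzero[OF a] by (simp add: hyperbolic_along_def)
qed

lemma self_in_open_cone:
  assumes "hyperbolic_along e"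
  shows "e \<in> open_cone e"
proof -
  have "h ((1 + t) *\<^sub>R e) \<noteq> 0" if "t \<ge> 0" for t
    using assms that by (simp only: h_scaleR) (simp add: hyperbolic_along_def)
  then show ?thesis
    by (simp add: open_cone_def scaleR_left_distrib)
qed

text \<open>The homotopy runs along the segment from \<open>e\<close> to \<open>b\<close>, with the
  right half plane as \<Omega>. On its frontier a nonzero t is not real, and hyperbolicity along
  \<open>a\<close> excludes it; t = 0 is excluded because the segment consists of points of the open
  cone. At the start, division by t leaves \<open>a\<close> plus \<open>1 / t\<close> times
  \<open>e\<close>, and \<open>1 / t\<close> has positive real part.\<close>

lemma nonzero_between:
  assumes e: "hyperbolic_along e" and a: "a \<in> open_cone e" and b: "b \<in> open_cone e"
    and "0 \<le> t"
  shows "h (b + t *\<^sub>R a) \<noteq> 0"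
proof (cases "t = 0")
  case True
  then show ?thesis
    using open_cone_nonzero[OF b] by simp
next
  case False
  define \<Omega> where "\<Omega> = {t. 0 < Re t}"
  define Z where "Z \<theta> = cvec (e + \<theta> *\<^sub>R (b - e))" for \<theta>
  have "H (Z 1 + complex_of_real t *s cvec a) \<noteq> 0"
  proof (rule zero_free_homotopy)
    show "H (cvec a) \<noteq> 0"
      using open_cone_nonzero[OF a] by (simp add: H_cvec)
    show "continuous_on {0..1} Z"
      unfolding Z_def by (intro continuous_intros)
    show "open \<Omega>"
      unfolding \<Omega>_def by (intro open_Collect_less continuous_intros)
    show "complex_of_real t \<in> \<Omega>"
      using \<open>0 \<le> t\<close> False by (simp add: \<Omega>_def)
  next
    fix \<theta> :: real and t assume \<theta>: "\<theta> \<in> {0..1}" and "t \<in> frontier \<Omega>"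
    then have Re: "Re t = 0"
      unfolding \<Omega>_def by (intro halfplane_frontier[of Re]) (auto intro!: continuous_intros)
    show "H (Z \<theta> + t *s cvec a) \<noteq> 0"
    proof (cases "Im t = 0")
      case False
      then show ?thesis
        using hyperbolic_along_open_cone[OF e a] by (simp add: hyperbolic_along_def Z_def)
    next
      case True
      with Re have "t = 0"
        by (simp add: complex_eq_iff)
      moreover have "h (e + \<theta> *\<^sub>R (b - e)) \<noteq> 0"
      proof (cases "\<theta> = 0")
        case True
        then show ?thesis
          using e by (simp add: hyperbolic_along_def)
      next
        case False
        then have "\<theta> *\<^sub>R (b + ((1 - \<theta>) / \<theta>) *\<^sub>R e) = \<theta> *\<^sub>R b + (1 - \<theta>) *\<^sub>R e"
          by (simp add: scaleR_right_distrib)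
        then have "e + \<theta> *\<^sub>R (b - e) = \<theta> *\<^sub>R (b + ((1 - \<theta>) / \<theta>) *\<^sub>R e)"
          by (simp add: algebra_simps)
        then show ?thesis
          using b \<theta> False by (simp add: h_scaleR open_cone_def)
      qed
      ultimately show ?thesis
        by (simp add: Z_def H_cvec)
    qed
  next
    fix t assume "t \<in> \<Omega>"
    then have t: "0 < Re t" "t \<noteq> 0"
      by (auto simp: \<Omega>_def)
    define u where "u = inverse t"
    have "H (Z 0 + t *s cvec a) = t ^ d * H (cvec a + u *s cvec e)"
      unfolding Z_def u_def using t by (subst H_rescale) simp_all
    moreover have "H (cvec a + u *s cvec e) \<noteq> 0"
    proof (cases "Im u = 0")
      case True
      then have u: "u = complex_of_real (Re u)"
        by (simp add: complex_eq_iff)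
      have "Re u \<ge> 0"
        using t by (simp add: u_def)
      with a show ?thesis
        by (subst u) (simp add: H_cvec_line open_cone_def)
    qed (use e in \<open>simp add: hyperbolic_along_def\<close>)
    ultimately show "H (Z 0 + t *s cvec a) \<noteq> 0"
      using t by simp
  qed
  then show ?thesis
    by (simp add: Z_def H_cvec_line)
qed

lemma open_cone_cong:
  assumes e: "hyperbolic_along e" and a: "a \<in> open_cone e"
  shows "open_cone a = open_cone e"
proof
  show "open_cone e \<subseteq> open_cone a"
    using nonzero_between[OF e a] by (auto simp: open_cone_def[of a])
  then have "e \<in> open_cone a"
    using self_in_open_cone[OF e] by blast
  then show "open_cone a \<subseteq> open_cone e"
    using nonzero_between[OF hyperbolic_along_open_cone[OF e a]]
    by (auto simp: open_cone_def[of e])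
qed

lemma open_cone_add:
  assumes e: "hyperbolic_along e" and "a \<in> open_cone e" "b \<in> open_cone e"
  shows "a + b \<in> open_cone e"
proof -
  have "h (a + b + t *\<^sub>R e) \<noteq> 0" if "t \<ge> 0" for t
  proof -
    have "b + t *\<^sub>R e \<in> open_cone e"
      using assms(3) that by (simp add: open_cone_def add.assoc flip: scaleR_left_distrib)
    from nonzero_between[OF e assms(2) this, of 1] show ?thesis
      by (simp add: ac_simps)
  qed
  then show ?thesis
    by (simp add: open_cone_def)
qed

text \<open>The cone can be tested with its own point \<open>a\<close> as direction. Then one ball
  around \<open>a\<close> controls the whole ray: \<open>x + t a\<close> is \<open>1 + t\<close>
  times a point that is no farther from \<open>a\<close> than \<open>x\<close> is.\<close>

lemma open_open_cone:
  assumes e: "hyperbolic_along e"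
  shows "open (open_cone e)"
  unfolding open_contains_ball
proof
  fix a assume a: "a \<in> open_cone e"
  have "continuous_on UNIV h"
    using h_differentiable by (simp add: differentiable_imp_continuous_on differentiable_on_def)
  then have "\<forall>\<^sub>F z in nhds a. h z \<noteq> 0"
    using open_cone_nonzero[OF a] by (intro tendsto_imp_eventually_ne[of h "h a"])
      (auto simp: continuous_on_def continuous_on_eq_continuous_at isCont_def tendsto_at_iff_tendsto_nhds)
  then obtain \<delta> where "\<delta> > 0" and \<delta>: "\<And>z. dist z a < \<delta> \<Longrightarrow> h z \<noteq> 0"
    by (auto simp: eventually_nhds_metric)
  have "x \<in> open_cone a" if "dist x a < \<delta>" for x
  proof -
    have "h (x + t *\<^sub>R a) \<noteq> 0" if "t \<ge> 0" for t
    proof -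
      have "norm (inverse (1 + t) *\<^sub>R (x - a)) \<le> 1 * norm (x - a)"
        unfolding norm_scaleR by (intro mult_right_mono) (use that in \<open>auto simp: field_simps\<close>)
      then have "h (a + inverse (1 + t) *\<^sub>R (x - a)) \<noteq> 0"
        using \<open>dist x a < \<delta>\<close> by (intro \<delta>) (simp add: dist_norm)
      moreover have "x + t *\<^sub>R a = (1 + t) *\<^sub>R (a + inverse (1 + t) *\<^sub>R (x - a))"
        using that by (simp add: scaleR_right_distrib scaleR_left_distrib)
      ultimately show ?thesis
        using that by (simp add: h_scaleR)
    qed
    then show ?thesis
      by (simp add: open_cone_def)
  qed
  then show "\<exists>r>0. ball a r \<subseteq> open_cone e"
    using \<open>\<delta> > 0\<close> open_cone_cong[OF e a] by (intro exI[of _ \<delta>]) (auto simp: dist_commute)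
qed

section \<open>The closed cone and its interior\<close>

lemma open_subset_closed_cone: "open_cone e \<subseteq> closed_cone e"
  by (auto simp: open_cone_def closed_cone_def)

lemma closed_cone_scaleR:
  assumes "a \<in> closed_cone e" "0 < r"
  shows "r *\<^sub>R a \<in> closed_cone e"
proof -
  have "h (r *\<^sub>R a + t *\<^sub>R e) \<noteq> 0" if "t > 0" for t
  proof -
    have "r *\<^sub>R a + t *\<^sub>R e = r *\<^sub>R (a + (t / r) *\<^sub>R e)"
      using assms(2) by (simp add: algebra_simps)
    then show ?thesis
      using assms that by (simp add: h_scaleR closed_cone_def)
  qed
  then show ?thesis
    by (simp add: closed_cone_def)
qed

text \<open>By openness a small multiple of \<open>e\<close> can be taken from \<open>a\<close> and
  given to \<open>x\<close>. This makes both summands points of the open cone.\<close>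

lemma closed_cone_add_open_cone:
  assumes e: "hyperbolic_along e" and x: "x \<in> closed_cone e" and a: "a \<in> open_cone e"
  shows "x + a \<in> open_cone e"
proof -
  obtain c where "0 < c" and c: "a - c *\<^sub>R e \<in> open_cone e"
    using open_shrink[OF open_open_cone[OF e] a] .
  then have "x + c *\<^sub>R e \<in> open_cone e"
    using x by (simp add: open_cone_def closed_cone_def add.assoc add_pos_nonneg flip: scaleR_left_distrib)
  from open_cone_add[OF e this c] show ?thesis
    by simp
qed

lemma closed_cone_cong:
  assumes e: "hyperbolic_along e" and a: "a \<in> open_cone e"
  shows "closed_cone a = closed_cone e"
proof -
  have *: "closed_cone e \<subseteq> closed_cone a" if "hyperbolic_along e" "a \<in> open_cone e" for a e
    using open_cone_nonzero[OF closed_cone_add_open_cone[OF that(1) _ open_cone_scaleR[OF that(2)]]]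
    by (auto simp: closed_cone_def[of a])
  show ?thesis
    using *[OF assms] *[OF hyperbolic_along_open_cone[OF assms]] open_cone_cong[OF assms]
      self_in_open_cone[OF e] by blast
qed

lemma interior_closed_cone:
  assumes "x \<in> interior (closed_cone e)"
  shows "x \<in> open_cone e"
proof -
  obtain c where "0 < c" "x - c *\<^sub>R e \<in> closed_cone e"
    using open_shrink[OF open_interior assms] interior_subset by blast
  then have "h (x - c *\<^sub>R e + (c + t) *\<^sub>R e) \<noteq> 0" if "0 \<le> t" for t
    using that by (simp add: closed_cone_def add_pos_nonneg del: diff_add_eq)
  then show ?thesis
    by (simp add: open_cone_def scaleR_left_distrib)
qed

section \<open>Real roots along a direction of hyperbolicity\<close>

lemma real_factorization:
  assumes e: "hyperbolic_along e"
  obtains \<mu> :: "nat \<Rightarrow> real"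
  where "\<And>t. H (cvec x + t *s cvec e) = complex_of_real (h e) * (\<Prod>i<d. t + complex_of_real (\<mu> i))"
    and "\<And>t. h (x + t *\<^sub>R e) = h e * (\<Prod>i<d. t + \<mu> i)"
proof -
  have he: "H (cvec e) \<noteq> 0"
    using e by (simp add: hyperbolic_along_def H_cvec)
  obtain \<rho> where \<rho>: "\<And>t. H (cvec x + t *s cvec e) = H (cvec e) * (\<Prod>i<d. t - \<rho> i)"
    using factorization[OF he] by metis
  have real: "\<rho> i = complex_of_real (Re (\<rho> i))" if "i < d" for i
  proof -
    have "H (cvec x + \<rho> i *s cvec e) = 0"
      unfolding \<rho> using that by auto
    with e have "Im (\<rho> i) = 0"
      by (auto simp: hyperbolic_along_def)
    then show ?thesis
      by (simp add: complex_eq_iff)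
  qed
  define \<mu> where "\<mu> i = - Re (\<rho> i)" for i
  have eq: "H (cvec x + t *s cvec e) = complex_of_real (h e) * (\<Prod>i<d. t + complex_of_real (\<mu> i))" for t
    unfolding \<rho> H_cvec \<mu>_def using real by (auto intro!: prod.cong)
  have "complex_of_real (h (x + t *\<^sub>R e)) = complex_of_real (h e * (\<Prod>i<d. t + \<mu> i))" for t
    unfolding H_cvec_line[symmetric] eq by simp
  then show thesis
    using that[OF eq] by (simp only: of_real_eq_iff)
qed

lemma open_cone_roots_pos:
  assumes "x \<in> open_cone e" "\<And>t. h (x + t *\<^sub>R e) = c * (\<Prod>i<d. t + \<mu> i)" "i < d"
  shows "0 < \<mu> i"
proof (rule ccontr)
  assume "\<not> ?thesis"
  then have "- \<mu> i \<ge> 0"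
    by simp
  then have "h (x + (- \<mu> i) *\<^sub>R e) \<noteq> 0"
    using assms(1) unfolding open_cone_def by blast
  moreover have "(\<Prod>j<d. - \<mu> i + \<mu> j) = 0"
    using assms(3) by (intro prod_zero) auto
  ultimately show False
    unfolding assms(2) by simp
qed

end


section \<open>Partial fractions with nonnegative coefficients\<close>

text \<open>As \<omega> runs over the closed upper unit half circle,
  \<open>\<kappa> / \<omega>^m\<close> sweeps an angle of m times pi, too much for a half plane
  unless m = 1. The arguments 0 and pi/m make \<kappa> real, pi/(2m) makes it nonnegative, and 3
  pi/(2m), which is available as soon as m is at least 2, would make it nonpositive. The end points
  of the arc are reached by continuity.\<close>

lemma halfplane_coefficient:
  fixes \<kappa> :: complex
  assumes neg: "\<And>\<omega>. 0 < Im \<omega> \<Longrightarrow> Im (\<kappa> / \<omega> ^ m) \<le> 0" and "\<kappa> \<noteq> 0" "0 < m"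
  shows "m = 1" and "\<kappa> = complex_of_real (Re \<kappa>)" and "0 \<le> Re \<kappa>"
proof -
  define f where "f \<phi> = Im (\<kappa> * cis (- (real m * \<phi>)))" for \<phi>
  have f: "f \<phi> \<le> 0" if "0 < \<phi>" "\<phi> < pi" for \<phi>
  proof -
    have "\<kappa> / cis \<phi> ^ m = \<kappa> * cis (- (real m * \<phi>))"
      by (simp add: Complex.DeMoivre divide_inverse)
    moreover have "0 < Im (cis \<phi>)"
      using that sin_gt_zero by simp
    ultimately show ?thesis
      unfolding f_def using neg by metis
  qed
  have f: "f \<phi> \<le> 0" if "\<phi> \<in> {0..pi}" for \<phi>
  proof (rule continuous_le_on_closure[of "{0<..<pi}" f])
    show "continuous_on (closure {0<..<pi}) f"
      unfolding f_def by (intro continuous_intros)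
    show "\<phi> \<in> closure {0<..<pi}"
      using that by (simp add: closure_greaterThanLessThan)
  qed (use f in auto)
  have "f 0 \<le> 0" "f (pi / m) \<le> 0" "f (pi / (2 * m)) \<le> 0"
    using \<open>0 < m\<close> by (auto intro!: f simp: divide_simps)
  then have "Im \<kappa> = 0" and Re: "0 \<le> Re \<kappa>"
    using \<open>0 < m\<close> by (simp_all add: f_def field_simps)
  then show "\<kappa> = complex_of_real (Re \<kappa>)" "0 \<le> Re \<kappa>"
    by (simp_all add: complex_eq_iff)
  show "m = 1"
  proof (rule ccontr)
    assume "m \<noteq> 1"
    with \<open>0 < m\<close> have "2 \<le> m"
      by simp
    then have "f (3 * pi / (2 * m)) \<le> 0"
      by (intro f) (simp add: divide_simps)
    moreover have "real m * (3 * pi / real (2 * m)) = pi + pi / 2"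
      using \<open>0 < m\<close> by (simp add: field_simps)
    ultimately have "Im (\<kappa> * cis (- (pi + pi / 2))) \<le> 0"
      unfolding f_def by metis
    moreover have "cis (- (pi + pi / 2)) = \<i>"
    proof -
      have "cis (- (pi + pi / 2)) = inverse (cis pi * cis (pi / 2))"
        by (simp only: cis_mult cis_inverse)
      then show ?thesis
        by simp
    qed
    ultimately have "Im (\<kappa> * \<i>) \<le> 0"
      by (simp only:)
    then have "Re \<kappa> \<le> 0"
      by simp
    with Re \<open>Im \<kappa> = 0\<close> \<open>\<kappa> \<noteq> 0\<close> show False
      by (simp add: complex_eq_iff)
  qed
qed

text \<open>
  Near a zero of multiplicity \<open>m\<close> of the denominator, the quotient behaves like \<open>\<kappa> / (s + a)^m\<close>,
  which stays in the lower half plane only if \<open>m = 1\<close> and \<open>\<kappa>\<close> is a nonnegative real.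
\<close>
lemma nonneg_partial_fractions:
  fixes a :: "'i \<Rightarrow> real" and k :: "complex poly"
  assumes "finite I" "k = 0 \<or> degree k < card I"
    and "\<And>s. 0 < Im s \<Longrightarrow> Im (poly k s / (\<Prod>i\<in>I. s + complex_of_real (a i))) \<le> 0"
  shows "\<exists>c. (\<forall>i\<in>I. 0 \<le> c i) \<and>
    (\<forall>s. poly k s = (\<Sum>i\<in>I. complex_of_real (c i) * (\<Prod>j\<in>I-{i}. s + complex_of_real (a j))))"
  using assms
proof (induction I arbitrary: k rule: finite_psubset_induct)
  case (psubset I)
  note neg = psubset.prems(2)
  show ?case
  \<comment> \<open>A common zero of numerator and denominator is cancelled, and the induction
    hypothesis applies. Otherwise every \<open>- a j\<close> is a true pole, and its order is the
    multiplicity of \<open>a j\<close>.\<close>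
  proof (cases "\<exists>j\<in>I. poly k (- complex_of_real (a j)) = 0")
    case True
    then obtain j where j: "j \<in> I" "poly k (- complex_of_real (a j)) = 0"
      by blast
    then obtain k1 where k1: "k = [:complex_of_real (a j), 1:] * k1"
      by (auto simp: poly_eq_0_iff_dvd dvd_def)
    have prod: "(\<Prod>i\<in>A. s + complex_of_real (a i)) = (s + complex_of_real (a j)) * (\<Prod>i\<in>A-{j}. s + complex_of_real (a i))"
      if "A \<subseteq> I" "j \<in> A" for s A
      using prod.remove[OF _ that(2)] finite_subset[OF that(1) psubset.hyps] by simp
    have "\<exists>c. (\<forall>i\<in>I-{j}. 0 \<le> c i) \<and>
      (\<forall>s. poly k1 s = (\<Sum>i\<in>I-{j}. complex_of_real (c i) * (\<Prod>l\<in>I-{j}-{i}. s + complex_of_real (a l))))"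
    proof (rule psubset.IH)
      show "I - {j} \<subset> I"
        using j by auto
      show "k1 = 0 \<or> degree k1 < card (I - {j})"
        using psubset.prems(1) j(1) psubset.hyps unfolding k1
        by (cases "k1 = 0") (auto simp: degree_mult_eq simp del: mult_pCons_left)
      fix s :: complex assume s: "0 < Im s"
      then have "s + complex_of_real (a j) \<noteq> 0"
        by (auto simp: complex_eq_iff)
      then show "Im (poly k1 s / (\<Prod>i\<in>I - {j}. s + complex_of_real (a i))) \<le> 0"
        using neg[OF s] by (simp add: k1 prod[OF order.refl j(1)] add.commute flip: distrib_right del: mult_pCons_left)
    qed
    then obtain c where c: "\<And>i. i \<in> I - {j} \<Longrightarrow> 0 \<le> c i"
      "\<And>s. poly k1 s = (\<Sum>i\<in>I-{j}. complex_of_real (c i) * (\<Prod>l\<in>I-{j}-{i}. s + complex_of_real (a l)))"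
      by blast
    \<comment> \<open>The cancelled factor is no pole of this quotient term, so its index receives
      the coefficient 0.\<close>
    define c' where "c' = c(j := 0)"
    have "poly k s = (\<Sum>i\<in>I. complex_of_real (c' i) * (\<Prod>l\<in>I-{i}. s + complex_of_real (a l)))" for s
    proof -
      have "(\<Sum>i\<in>I. complex_of_real (c' i) * (\<Prod>l\<in>I-{i}. s + complex_of_real (a l)))
          = (\<Sum>i\<in>I-{j}. complex_of_real (c' i) * (\<Prod>l\<in>I-{i}. s + complex_of_real (a l)))"
        using psubset.hyps j(1) by (simp add: sum.remove c'_def)
      also have "\<dots> = (\<Sum>i\<in>I-{j}. (s + complex_of_real (a j)) * (complex_of_real (c i) * (\<Prod>l\<in>I-{j}-{i}. s + complex_of_real (a l))))"
      proof (intro sum.cong refl)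
        fix i assume i: "i \<in> I - {j}"
        have "I - {i} - {j} = I - {j} - {i}"
          by auto
        then show "complex_of_real (c' i) * (\<Prod>l\<in>I-{i}. s + complex_of_real (a l))
          = (s + complex_of_real (a j)) * (complex_of_real (c i) * (\<Prod>l\<in>I-{j}-{i}. s + complex_of_real (a l)))"
          using prod[of "I - {i}" s] i j(1) by (auto simp: c'_def)
      qed
      also have "\<dots> = poly k s"
        by (simp add: k1 c(2) add.commute flip: sum_distrib_left del: mult_pCons_left)
      finally show ?thesis
        by simp
    qed
    moreover have "\<forall>i\<in>I. 0 \<le> c' i"
      using c(1) by (auto simp: c'_def)
    ultimately show ?thesis
      by blast
  next
    case False
    \<comment> \<open>The leading coefficient at the pole \<open>- a j\<close>: all factors with the
      same root are removed from the denominator, the others are evaluated at the pole.\<close>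
    define \<kappa> where "\<kappa> j = poly k (- complex_of_real (a j)) /
      (\<Prod>i\<in>{i\<in>I. a i \<noteq> a j}. complex_of_real (a i - a j))" for j
    have key: "card {i\<in>I. a i = a j} = 1 \<and> \<kappa> j = complex_of_real (Re (\<kappa> j)) \<and> 0 \<le> Re (\<kappa> j)"
      if j: "j \<in> I" for j
    proof -
      define J where "J = {i\<in>I. a i \<noteq> a j}"
      define m where "m = card {i\<in>I. a i = a j}"
      have "0 < m"
        using j psubset.hyps by (auto simp: m_def card_gt_0_iff)
      have "finite J"
        using psubset.hyps by (simp add: J_def)
      have "\<kappa> j \<noteq> 0"
        using False j \<open>finite J\<close> by (auto simp: \<kappa>_def J_def)
      have limit: "Im (\<kappa> j / \<omega> ^ m) \<le> 0" if "0 < Im \<omega>" for \<omega>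
      proof -
        have "\<omega> \<noteq> 0"
          using that by auto
        \<comment> \<open>This is \<rho>^m times the quotient at the point
          \<open>- a j + \<rho> \<omega>\<close> of the upper half plane. The positive factor keeps
          the sign of the imaginary part and makes the limit at \<rho> = 0 exist.\<close>
        define q where "q \<rho> = poly k (- complex_of_real (a j) + complex_of_real \<rho> * \<omega>) /
          (\<omega> ^ m * (\<Prod>i\<in>J. complex_of_real (a i - a j) + complex_of_real \<rho> * \<omega>))" for \<rho>
        have "(q \<longlongrightarrow> poly k (- complex_of_real (a j) + complex_of_real 0 * \<omega>) /
          (\<omega> ^ m * (\<Prod>i\<in>J. complex_of_real (a i - a j) + complex_of_real 0 * \<omega>))) (at_right 0)"
          unfolding q_def using \<open>\<omega> \<noteq> 0\<close> \<open>finite J\<close>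
          by (intro tendsto_intros) (auto simp: J_def)
        then have "(q \<longlongrightarrow> \<kappa> j / \<omega> ^ m) (at_right 0)"
          by (simp add: \<kappa>_def J_def mult.commute)
        then have "((\<lambda>\<rho>. Im (q \<rho>)) \<longlongrightarrow> Im (\<kappa> j / \<omega> ^ m)) (at_right 0)"
          by (rule tendsto_Im)
        moreover have "\<forall>\<^sub>F \<rho> in at_right 0. Im (q \<rho>) \<le> 0"
          using eventually_at_right_less
        proof eventually_elim
          fix \<rho> :: real assume "0 < \<rho>"
          define s where "s = - complex_of_real (a j) + complex_of_real \<rho> * \<omega>"
          have "I = {i\<in>I. a i = a j} \<union> J"
            by (auto simp: J_def)
          then have "(\<Prod>i\<in>I. s + complex_of_real (a i)) = (\<Prod>i\<in>{i\<in>I. a i = a j} \<union> J. s + complex_of_real (a i))"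
            by (rule prod.cong) simp
          also have "\<dots> = (\<Prod>i\<in>{i\<in>I. a i = a j}. s + complex_of_real (a i)) * (\<Prod>i\<in>J. s + complex_of_real (a i))"
            by (rule prod.union_disjoint) (use psubset.hyps in \<open>auto simp: J_def\<close>)
          also have "(\<Prod>i\<in>{i\<in>I. a i = a j}. s + complex_of_real (a i)) = (complex_of_real \<rho> * \<omega>) ^ m"
            unfolding m_def by (simp add: s_def flip: prod_constant)
          also have "(\<Prod>i\<in>J. s + complex_of_real (a i)) = (\<Prod>i\<in>J. complex_of_real (a i - a j) + complex_of_real \<rho> * \<omega>)"
            by (intro prod.cong refl) (simp add: s_def)
          finally have "q \<rho> = \<rho> ^ m *\<^sub>R (poly k s / (\<Prod>i\<in>I. s + complex_of_real (a i)))"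
            using \<open>0 < \<rho>\<close> by (simp add: q_def power_mult_distrib s_def scaleR_conv_of_real)
          moreover have "Im (poly k s / (\<Prod>i\<in>I. s + complex_of_real (a i))) \<le> 0"
            using \<open>0 < \<rho>\<close> that by (intro neg) (simp add: s_def)
          ultimately show "Im (q \<rho>) \<le> 0"
            using \<open>0 < \<rho>\<close> by (simp only: complex_scaleR) (simp add: mult_nonneg_nonpos)
        qed
        ultimately show ?thesis
          by (rule tendsto_upperbound) simp
      qed
      show ?thesis
        using halfplane_coefficient[of "\<kappa> j" m, OF limit \<open>\<kappa> j \<noteq> 0\<close> \<open>0 < m\<close>] by (simp add: m_def)
    qed
    have inj: "i = j" if "i \<in> I" "j \<in> I" "a i = a j" for i j
    proof -
      obtain x where "{i\<in>I. a i = a j} = {x}"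
        using key[OF \<open>j \<in> I\<close>] by (auto simp: card_1_singleton_iff)
      moreover have "i \<in> {i\<in>I. a i = a j}" "j \<in> {i\<in>I. a i = a j}"
        using \<open>i \<in> I\<close> \<open>j \<in> I\<close> \<open>a i = a j\<close> by auto
      ultimately show ?thesis
        by simp
    qed
    define G where "G = (\<Sum>i\<in>I. smult (complex_of_real (Re (\<kappa> i))) (\<Prod>j\<in>I-{i}. [:complex_of_real (a j), 1:]))"
    have G: "poly G s = (\<Sum>i\<in>I. complex_of_real (Re (\<kappa> i)) * (\<Prod>j\<in>I-{i}. s + complex_of_real (a j)))" for s
      by (simp add: G_def poly_sum poly_prod add.commute)
    \<comment> \<open>Interpolation: the poles are distinct by \<open>inj\<close>, both polynomials
      have degree below \<open>card I\<close>, and they agree at the \<open>card I\<close>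
      poles.\<close>
    have "k = G"
    proof (cases "I = {}")
      case True
      then show ?thesis
        using psubset.prems(1) by (simp add: G_def)
    next
      case False
      then have "0 < card I"
        using psubset.hyps by (simp add: card_gt_0_iff)
      define A where "A = (\<lambda>i. - complex_of_real (a i)) ` I"
      have "card A = card I"
        unfolding A_def by (intro card_image inj_onI inj) auto
      show ?thesis
      proof (rule poly_eqI_degree)
        show "degree k < card A"
          using psubset.prems(1) \<open>0 < card I\<close> \<open>card A = card I\<close> by auto
        have "degree G \<le> card I - 1"
          unfolding G_def
        proof (rule degree_sum_le)
          fix i assume "i \<in> I"
          have "degree (\<Prod>j\<in>I-{i}. [:complex_of_real (a j), 1:]) \<le> card (I - {i})"
            using degree_prod_sum_le[of "I - {i}" "\<lambda>j. [:complex_of_real (a j), 1:]"] psubset.hyps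
            by (simp add: o_def)
          then show "degree (smult (complex_of_real (Re (\<kappa> i))) (\<Prod>j\<in>I-{i}. [:complex_of_real (a j), 1:])) \<le> card I - 1"
            using \<open>i \<in> I\<close> by (intro order.trans[OF degree_smult_le]) simp
        qed (use psubset.hyps in auto)
        then show "degree G < card A"
          using \<open>0 < card I\<close> \<open>card A = card I\<close> by auto
        fix s assume "s \<in> A"
        then obtain j where j: "j \<in> I" "s = - complex_of_real (a j)"
          by (auto simp: A_def)
        have J: "{i\<in>I. a i \<noteq> a j} = I - {j}"
          using inj j(1) by auto
        have "poly G s = complex_of_real (Re (\<kappa> j)) * (\<Prod>i\<in>I-{j}. s + complex_of_real (a i))"
          unfolding G
        proof (subst sum.remove[OF psubset.hyps j(1)], subst sum.neutral)
          show "\<forall>i\<in>I-{j}. complex_of_real (Re (\<kappa> i)) * (\<Prod>l\<in>I-{i}. s + complex_of_real (a l)) = 0"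
          proof
            fix i assume "i \<in> I - {j}"
            then have "(\<Prod>l\<in>I-{i}. s + complex_of_real (a l)) = 0"
              using psubset.hyps j by (intro prod_zero) auto
            then show "complex_of_real (Re (\<kappa> i)) * (\<Prod>l\<in>I-{i}. s + complex_of_real (a l)) = 0"
              by simp
          qed
        qed simp
        also have "\<dots> = \<kappa> j * (\<Prod>i\<in>I-{j}. complex_of_real (a i - a j))"
          using key[OF j(1)] by (simp add: j(2))
        also have "\<dots> = poly k s"
          unfolding \<kappa>_def J using inj j psubset.hyps by (auto simp: prod_zero_iff)
        finally show "poly k s = poly G s"
          by simp
      qed
    qed
    then show ?thesis
      using key G by (intro exI[of _ "\<lambda>i. Re (\<kappa> i)"]) auto
  qed
qed

text \<open>With r = \<open>1 / a i\<close> the exact identity is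
  \<open>1 / (s + a i) = r - s r^2 / (1 + s r)\<close>. The function s / (1 + s r) decreases in r
  for either sign of s while 1 + s r is positive, so replacing r by the larger T in the denominator
  only increases the right-hand side. The gain is a denominator that does not depend on i.\<close>

lemma resolvent_bound:
  fixes a c :: "'i \<Rightarrow> real"
  assumes "finite I" and a: "\<And>i. i \<in> I \<Longrightarrow> 0 < a i" and c: "\<And>i. i \<in> I \<Longrightarrow> 0 \<le> c i"
    and T: "T = (\<Sum>i\<in>I. 1 / a i)" and s: "0 < 1 + s * T"
  shows "\<And>i. i \<in> I \<Longrightarrow> 0 < s + a i"
    and "(\<Sum>i\<in>I. c i / (s + a i)) \<le> (\<Sum>i\<in>I. c i / a i) - s * (\<Sum>i\<in>I. c i / (a i)\<^sup>2) / (1 + s * T)"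
proof -
  have T_ge: "1 / a i \<le> T" if "i \<in> I" for i
    unfolding T using member_le_sum[of i I "\<lambda>i. 1 / a i"] that a \<open>finite I\<close> by (simp add: less_imp_le)
  have pos: "0 < 1 + s * (1 / a i)" if "i \<in> I" for i
  proof (cases "s \<ge> 0")
    case True
    then show ?thesis
      using a[OF that] by (simp add: add_pos_nonneg)
  next
    case False
    then have "s * T \<le> s * (1 / a i)"
      using T_ge[OF that] by (intro mult_left_mono_neg) auto
    with s show ?thesis
      by simp
  qed
  show *: "0 < s + a i" if "i \<in> I" for i
    using pos[OF that] a[OF that] by (simp add: field_simps)
  have "c i / (s + a i) \<le> c i / a i - s * (c i / (a i)\<^sup>2) / (1 + s * T)" if i: "i \<in> I" for i
  proof -
    have "1 / a i - s * (1 / (a i)\<^sup>2) / (1 + s * T) - 1 / (s + a i)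
        = s\<^sup>2 * (T - 1 / a i) / (a i * (s + a i) * (1 + s * T))"
      using a[OF i] *[OF i] s by (simp add: divide_simps power2_eq_square) algebra
    moreover have "\<dots> \<ge> 0"
      using a[OF i] *[OF i] s T_ge[OF i] by (intro divide_nonneg_pos mult_nonneg_nonneg) auto
    ultimately have "1 / (s + a i) \<le> 1 / a i - s * (1 / (a i)\<^sup>2) / (1 + s * T)"
      by simp
    from mult_left_mono[OF this c[OF i]] show ?thesis
      by (simp add: right_diff_distrib mult.commute)
  qed
  then have "(\<Sum>i\<in>I. c i / (s + a i)) \<le> (\<Sum>i\<in>I. c i / a i - s * (c i / (a i)\<^sup>2) / (1 + s * T))"
    by (rule sum_mono)
  then show "(\<Sum>i\<in>I. c i / (s + a i)) \<le> (\<Sum>i\<in>I. c i / a i) - s * (\<Sum>i\<in>I. c i / (a i)\<^sup>2) / (1 + s * T)"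
    by (simp add: sum_subtractf sum_distrib_left sum_divide_distrib)
qed

lemma has_field_derivative_line:
  fixes f :: "'a::real_normed_vector \<Rightarrow> real"
  assumes "f differentiable (at x)"
  shows "((\<lambda>r. f (x + r *\<^sub>R v)) has_field_derivative frechet_derivative f (at x) v) (at 0)"
proof -
  have "(f has_derivative frechet_derivative f (at x)) (at x)"
    using assms frechet_derivative_works by blast
  then have f: "(f has_derivative frechet_derivative f (at x)) (at (x + 0 *\<^sub>R v))"
    by simp
  have "((\<lambda>r::real. x + r *\<^sub>R v) has_derivative (\<lambda>r. r *\<^sub>R v)) (at 0)"
    by (auto intro!: derivative_eq_intros)
  from has_derivative_compose[OF this f]
  have "((\<lambda>r. f (x + r *\<^sub>R v)) has_derivative (\<lambda>r. frechet_derivative f (at x) (r *\<^sub>R v))) (at 0)" .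
  moreover have "(\<lambda>r. frechet_derivative f (at x) (r *\<^sub>R v)) = (*) (frechet_derivative f (at x) v)"
    using linear_frechet_derivative[OF assms] by (auto simp: linear_cmul)
  ultimately show ?thesis
    by (simp add: has_field_derivative_def)
qed

lemma eventually_roots_pos:
  fixes a :: "nat \<Rightarrow> real"
  assumes "\<And>i. i < n \<Longrightarrow> 0 < a i"
  shows "\<forall>\<^sub>F t in nhds 0. \<forall>i<n. 0 < t + a i"
proof -
  have "\<forall>\<^sub>F t in nhds 0. 0 < t + a i" if "i \<in> {..<n}" for i
  proof -
    have "open {t. 0 < t + a i}"
      by (intro open_Collect_less continuous_intros)
    then have "\<forall>\<^sub>F t in nhds 0. t \<in> {t. 0 < t + a i}"
      by (rule eventually_nhds_in_open) (use assms that in simp)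
    then show ?thesis
      by simp
  qed
  then have "\<forall>i\<in>{..<n}. \<forall>\<^sub>F t in nhds 0. 0 < t + a i"
    by blast
  then have "\<forall>\<^sub>F t in nhds 0. \<forall>i\<in>{..<n}. 0 < t + a i"
    by (rule eventually_ball_finite[OF finite_lessThan])
  then show ?thesis
    by (simp add: Ball_def)
qed


section \<open>The barrier\<close>

context homogeneous_form
begin

text \<open>
  \<open>ratio v x\<close> is the derivative of \<open>ln h\<close> at \<open>x\<close> in direction \<open>v\<close>, and \<open>curvature e x v\<close> is minus
  the mixed second derivative of \<open>ln h\<close> at \<open>x\<close> in directions \<open>e\<close> and \<open>v\<close>.
\<close>
definition ratio :: "real^'n \<Rightarrow> real^'n \<Rightarrow> real" where
  "ratio v x = k v x / h x"

definition curvature :: "real^'n \<Rightarrow> real^'n \<Rightarrow> real^'n \<Rightarrow> real" where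
  "curvature e x v = - frechet_derivative (ratio e) (at x) v"

section \<open>The logarithmic derivative of \<open>h\<close> and its linearity in the
  direction\<close>

lemma h_line_derivative: "((\<lambda>r. h (x + r *\<^sub>R v)) has_field_derivative k v x) (at 0)"
proof -
  have "((\<lambda>r. H (cvec x + r *s cvec v)) has_field_derivative K v (cvec x)) (at (complex_of_real 0))"
    using H_derivative by simp
  then have "((\<lambda>r. H (cvec x + complex_of_real r *s cvec v)) has_vector_derivative K v (cvec x)) (at 0)"
    by (rule has_vector_derivative_real_field)
  from has_field_derivative_Re[OF this] show ?thesis
    by (simp add: H_cvec_line K_cvec)
qed

lemma k_eq_frechet: "k v x = frechet_derivative h (at x) v"
  using DERIV_unique[OF h_line_derivative has_field_derivative_line[OF h_differentiable]] .

lemma ratio_differentiable: "h x \<noteq> 0 \<Longrightarrow> ratio v differentiable (at x)"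
  unfolding ratio_def[abs_def] by (intro differentiable_divide k_differentiable h_differentiable)

lemma linear_ratio: "linear (\<lambda>v. ratio v x)"
  unfolding ratio_def k_eq_frechet divide_inverse
  by (intro linear_compose[OF linear_frechet_derivative[OF h_differentiable], unfolded o_def]
      bounded_linear.linear[OF bounded_linear_mult_left])

lemma linear_curvature: "h x \<noteq> 0 \<Longrightarrow> linear (curvature e x)"
  unfolding curvature_def[abs_def]
  by (intro linear_compose_neg linear_frechet_derivative ratio_differentiable)

lemma isCont_ratio: "h x \<noteq> 0 \<Longrightarrow> isCont (ratio v) x"
  by (intro differentiable_imp_continuous_within ratio_differentiable)

text \<open>The quotient is the logarithmic derivative of \<open>H\<close> in direction
  \<open>e\<close>, hence the sum of the \<open>1 / (0 - \<rho> i)\<close> over the zeros \<rho> of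
  t \<mapsto> \<open>H (z + t e)\<close>. A zero with nonnegative imaginary part would give a point
  whose imaginary part \<open>Im s x + Im (\<rho> i) e\<close> lies in the open cone, contrary to
  \<open>stable\<close>. So each \<open>0 - \<rho> i\<close> is in the upper half plane and its
  reciprocal in the lower one.\<close>

lemma Im_quotient_nonpos:
  assumes e: "hyperbolic_along e" and x: "x \<in> open_cone e" and s: "0 < Im s"
    and z_def: "z = cvec b + s *s cvec x"
  shows "Im (K e z / H z) \<le> 0"
proof -
  have he: "H (cvec e) \<noteq> 0"
    using e by (simp add: hyperbolic_along_def H_cvec)
  obtain \<rho> where \<rho>: "\<And>t. H (z + t *s cvec e) = H (cvec e) * (\<Prod>i<d. t - \<rho> i)"
    using factorization[OF he] by metis
  have neg: "Im (\<rho> i) < 0" if "i < d" for i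
  proof (rule ccontr)
    assume "\<not> ?thesis"
    then have "0 \<le> Im (\<rho> i)"
      by simp
    then have "Im s *\<^sub>R x + Im (\<rho> i) *\<^sub>R e \<in> open_cone e"
      using open_cone_scaleR[OF x s] by (simp add: open_cone_def add.assoc flip: scaleR_left_distrib)
    from stable[OF e this]
    have "H (cvec (b + Re s *\<^sub>R x + Re (\<rho> i) *\<^sub>R e) + \<i> *s cvec (Im s *\<^sub>R x + Im (\<rho> i) *\<^sub>R e)) \<noteq> 0" .
    moreover have "z + \<rho> i *s cvec e = cvec (b + Re s *\<^sub>R x + Re (\<rho> i) *\<^sub>R e) + \<i> *s cvec (Im s *\<^sub>R x + Im (\<rho> i) *\<^sub>R e)"
      by (simp add: z_def vec_eq_iff complex_eq_iff)
    moreover have "H (z + \<rho> i *s cvec e) = 0"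
      unfolding \<rho> using that by auto
    ultimately show False
      by simp
  qed
  have nz: "\<rho> i \<noteq> 0" if "i < d" for i
    using neg[OF that] by auto
  have "((\<lambda>t. \<Prod>i<d. t - \<rho> i) has_field_derivative (\<Prod>i<d. 0 - \<rho> i) * (\<Sum>i<d. 1 / (0 - \<rho> i))) (at 0)"
    by (rule has_field_derivative_prod') (auto simp: nz intro!: derivative_eq_intros)
  from DERIV_cmult[OF this, of "H (cvec e)"]
  have "((\<lambda>t. H (z + t *s cvec e)) has_field_derivative H (cvec e) * ((\<Prod>i<d. 0 - \<rho> i) * (\<Sum>i<d. 1 / (0 - \<rho> i)))) (at 0)"
    by (simp only: \<rho>)
  with H_derivative have "K e z = H (cvec e) * ((\<Prod>i<d. 0 - \<rho> i) * (\<Sum>i<d. 1 / (0 - \<rho> i)))"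
    by (rule DERIV_unique)
  moreover have "H z = H (cvec e) * (\<Prod>i<d. 0 - \<rho> i)"
    using \<rho>[of 0] by simp
  moreover have "(\<Prod>i<d. 0 - \<rho> i) \<noteq> 0"
    using nz by simp
  ultimately have "K e z / H z = (\<Sum>i<d. 1 / (0 - \<rho> i))"
    using he by simp
  also have "Im \<dots> = (\<Sum>i<d. Im (1 / (0 - \<rho> i)))"
    by simp
  also have "\<dots> \<le> 0"
    by (intro sum_nonpos) (use neg in \<open>auto simp: Im_divide divide_nonpos_nonneg less_imp_le\<close>)
  finally show ?thesis .
qed

lemma ratio_eq_sum:
  assumes "\<And>r. h (x + r *\<^sub>R v) = c * (\<Prod>i<d. r + a i)" "h x \<noteq> 0"
  shows "ratio v x = (\<Sum>i<d. 1 / a i)"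
proof -
  have hx: "h x = c * (\<Prod>i<d. a i)"
    using assms(1)[of 0] by simp
  have "((\<lambda>r. \<Prod>i<d. r + a i) has_field_derivative (\<Prod>i<d. 0 + a i) * (\<Sum>i<d. 1 / (0 + a i))) (at 0)"
    by (rule has_field_derivative_prod') (use hx assms(2) in \<open>auto intro!: derivative_eq_intros\<close>)
  from DERIV_cmult[OF this, of c]
  have "((\<lambda>r. h (x + r *\<^sub>R v)) has_field_derivative c * ((\<Prod>i<d. 0 + a i) * (\<Sum>i<d. 1 / (0 + a i)))) (at 0)"
    by (simp only: assms(1))
  with h_line_derivative have "k v x = c * ((\<Prod>i<d. 0 + a i) * (\<Sum>i<d. 1 / (0 + a i)))"
    by (rule DERIV_unique)
  then show ?thesis
    using assms(2) hx by (simp add: ratio_def)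
qed

lemma curvature_eq_sum:
  assumes "\<forall>\<^sub>F t in nhds 0. ratio e (b + t *\<^sub>R x) = (\<Sum>i<d. c i / (t + a i))"
    and "\<And>i. i < d \<Longrightarrow> a i \<noteq> 0" and hb: "h b \<noteq> 0"
  shows "curvature e b x = (\<Sum>i<d. c i / (a i)\<^sup>2)"
proof -
  have "((\<lambda>t. \<Sum>i<d. c i / (t + a i)) has_field_derivative (\<Sum>i<d. - (c i / (a i)\<^sup>2))) (at 0)"
    by (intro DERIV_sum derivative_eq_intros refl) (use assms(2) in \<open>auto simp: power2_eq_square\<close>)
  then have "((\<lambda>t. ratio e (b + t *\<^sub>R x)) has_field_derivative (\<Sum>i<d. - (c i / (a i)\<^sup>2))) (at 0)"
    by (subst DERIV_cong_ev[OF refl assms(1) refl])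
  from DERIV_unique[OF this has_field_derivative_line[OF ratio_differentiable[OF hb]]] show ?thesis
    by (simp add: curvature_def sum_negf flip: minus_equation_iff)
qed

text \<open>One family \<open>a\<close> serves two purposes. The zeros of \<open>h\<close> on the
  line from \<open>b\<close> in direction \<open>x\<close> are the possible poles of
  \<open>ratio e\<close> there, and the reciprocals of the \<open>a i\<close> add up to
  \<open>ratio x b\<close>. This is what provides the T of \<open>resolvent_bound\<close>.\<close>

lemma ratio_partial_fractions:
  assumes e: "hyperbolic_along e" and b: "b \<in> open_cone e" and x: "x \<in> open_cone e"
  obtains a c :: "nat \<Rightarrow> real"
  where "\<And>t. h (b + t *\<^sub>R x) = h x * (\<Prod>i<d. t + a i)"
    and "\<And>i. i < d \<Longrightarrow> 0 < a i" and "\<And>i. i < d \<Longrightarrow> 0 \<le> c i"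
    and "\<And>t. \<forall>i<d. t + a i \<noteq> 0 \<Longrightarrow> ratio e (b + t *\<^sub>R x) = (\<Sum>i<d. c i / (t + a i))"
    and "ratio x b = (\<Sum>i<d. 1 / a i)" and "curvature e b x = (\<Sum>i<d. c i / (a i)\<^sup>2)"
proof -
  have hyp_x: "hyperbolic_along x" and cone_x: "open_cone x = open_cone e"
    using hyperbolic_along_open_cone[OF e x] open_cone_cong[OF e x] .
  have hb: "h b \<noteq> 0"
    using open_cone_nonzero[OF b] .
  obtain a :: "nat \<Rightarrow> real" where
    Ha: "\<And>t. H (cvec b + t *s cvec x) = complex_of_real (h x) * (\<Prod>i<d. t + complex_of_real (a i))" and
    ha: "\<And>t. h (b + t *\<^sub>R x) = h x * (\<Prod>i<d. t + a i)"
    using real_factorization[OF hyp_x, of b] by blast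
  have a: "0 < a i" if "i < d" for i
    using open_cone_roots_pos[of b x] ha that b cone_x by blast
  obtain P where P: "degree P < d" "\<And>t. K e (cvec b + t *s cvec x) = poly P t"
    using K_line by metis
  define k' where "k' = smult (1 / complex_of_real (h x)) P"
  have k': "poly k' t / (\<Prod>i<d. t + complex_of_real (a i)) = K e (cvec b + t *s cvec x) / H (cvec b + t *s cvec x)" for t
    by (simp add: k'_def P(2) Ha)
  have "\<exists>c. (\<forall>i\<in>{..<d}. 0 \<le> c i) \<and>
    (\<forall>s. poly k' s = (\<Sum>i<d. complex_of_real (c i) * (\<Prod>j\<in>{..<d}-{i}. s + complex_of_real (a j))))"
  proof (rule nonneg_partial_fractions)
    show "k' = 0 \<or> degree k' < card {..<d}"
      using P(1) by (simp add: k'_def)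
    show "Im (poly k' s / (\<Prod>i<d. s + complex_of_real (a i))) \<le> 0" if "0 < Im s" for s
      unfolding k' using Im_quotient_nonpos[OF e x that refl] .
  qed simp
  then obtain c where c: "\<And>i. i < d \<Longrightarrow> 0 \<le> c i"
    and k'_eq: "\<And>s. poly k' s = (\<Sum>i<d. complex_of_real (c i) * (\<Prod>j\<in>{..<d}-{i}. s + complex_of_real (a j)))"
    by auto
  have ratio_eq: "ratio e (b + t *\<^sub>R x) = (\<Sum>i<d. c i / (t + a i))" if t: "\<forall>i<d. t + a i \<noteq> 0" for t
  proof -
    have t': "complex_of_real t + complex_of_real (a i) \<noteq> 0" if "i < d" for i
      using t that by (simp flip: of_real_add)
    have "complex_of_real (ratio e (b + t *\<^sub>R x)) = poly k' (complex_of_real t) / (\<Prod>i<d. complex_of_real t + complex_of_real (a i))"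
      unfolding k' by (simp add: ratio_def H_cvec K_cvec flip: cvec_add cvec_scaleR)
    also have "\<dots> = (\<Sum>i<d. complex_of_real (c i) / (complex_of_real t + complex_of_real (a i)))"
      unfolding k'_eq sum_divide_distrib
    proof (intro sum.cong refl)
      fix i assume i: "i \<in> {..<d}"
      have "(\<Prod>j<d. complex_of_real t + complex_of_real (a j)) = (complex_of_real t + complex_of_real (a i)) *
          (\<Prod>j\<in>{..<d}-{i}. complex_of_real t + complex_of_real (a j))"
        using i by (simp add: prod.remove)
      moreover have "(\<Prod>j\<in>{..<d}-{i}. complex_of_real t + complex_of_real (a j)) \<noteq> 0"
        using t' by simp
      ultimately show "complex_of_real (c i) * (\<Prod>j\<in>{..<d}-{i}. complex_of_real t + complex_of_real (a j)) /
          (\<Prod>j<d. complex_of_real t + complex_of_real (a j)) = complex_of_real (c i) / (complex_of_real t + complex_of_real (a i))"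
        by simp
    qed
    also have "\<dots> = complex_of_real (\<Sum>i<d. c i / (t + a i))"
      by simp
    finally show ?thesis
      by (simp only: of_real_eq_iff)
  qed
  have "\<forall>\<^sub>F t in nhds 0. \<forall>i<d. 0 < t + a i"
    by (rule eventually_roots_pos) (rule a)
  then have "\<forall>\<^sub>F t in nhds 0. ratio e (b + t *\<^sub>R x) = (\<Sum>i<d. c i / (t + a i))"
    by eventually_elim (auto intro!: ratio_eq)
  from curvature_eq_sum[OF this _ hb] a have "curvature e b x = (\<Sum>i<d. c i / (a i)\<^sup>2)"
    by force
  with ha a c ratio_eq ratio_eq_sum[OF ha hb] show thesis
    by (rule that)
qed

section \<open>The first order bound for the barrier\<close>

lemma barrier_step_open:
  assumes e: "hyperbolic_along e" and b: "b \<in> open_cone e" and x: "x \<in> open_cone e"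
    and s: "0 < 1 + s * ratio x b"
  shows "b + s *\<^sub>R x \<in> open_cone e"
    and "ratio e (b + s *\<^sub>R x) \<le> ratio e b - s * curvature e b x / (1 + s * ratio x b)"
proof -
  have cone_x: "open_cone x = open_cone e"
    using open_cone_cong[OF e x] .
  obtain a c :: "nat \<Rightarrow> real"
    where ha: "\<And>t. h (b + t *\<^sub>R x) = h x * (\<Prod>i<d. t + a i)"
      and a: "\<And>i. i < d \<Longrightarrow> 0 < a i" and c: "\<And>i. i < d \<Longrightarrow> 0 \<le> c i"
      and ratio_eq: "\<And>t. \<forall>i<d. t + a i \<noteq> 0 \<Longrightarrow> ratio e (b + t *\<^sub>R x) = (\<Sum>i<d. c i / (t + a i))"
      and T: "ratio x b = (\<Sum>i<d. 1 / a i)" and curv: "curvature e b x = (\<Sum>i<d. c i / (a i)\<^sup>2)"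
    by (rule ratio_partial_fractions[OF e b x]) (rule that)
  have pos: "0 < s + a i" if "i < d" for i
    using resolvent_bound(1)[of "{..<d}" a c "ratio x b" s i] a c T s that by simp
  have "ratio e b = (\<Sum>i<d. c i / a i)"
    using ratio_eq[of 0] a by force
  moreover have "ratio e (b + s *\<^sub>R x) = (\<Sum>i<d. c i / (s + a i))"
    using pos by (intro ratio_eq) force
  ultimately show "ratio e (b + s *\<^sub>R x) \<le> ratio e b - s * curvature e b x / (1 + s * ratio x b)"
    using resolvent_bound(2)[of "{..<d}" a c "ratio x b" s] a c T s curv by simp
  have "h (b + s *\<^sub>R x + t *\<^sub>R x) \<noteq> 0" if "0 \<le> t" for t
  proof -
    have "t + s + a i \<noteq> 0" if "i < d" for i
      using pos[OF that] \<open>0 \<le> t\<close> by linarith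
    then have "h (b + (t + s) *\<^sub>R x) \<noteq> 0"
      using open_cone_nonzero[OF x] by (simp add: ha)
    then show ?thesis
      by (simp add: scaleR_left_distrib ac_simps)
  qed
  then have "b + s *\<^sub>R x \<in> open_cone x"
    by (simp add: open_cone_def)
  then show "b + s *\<^sub>R x \<in> open_cone e"
    by (simp add: cone_x)
qed

text \<open>Approximation of \<open>x\<close> by \<open>y \<eta> = x + \<eta> e\<close>. The
  inequality passes to the limit because both \<open>ratio (y \<eta>) b\<close> and
  \<open>curvature e b (y \<eta>)\<close> are linear in \<open>y \<eta>\<close>. Membership in an
  open set does not pass to a limit and is shown separately.\<close>

lemma barrier_step:
  assumes e: "hyperbolic_along e" and b: "b \<in> open_cone e" and x: "x \<in> closed_cone e"
    and s: "0 < 1 + s * ratio x b"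
  shows "b + s *\<^sub>R x \<in> open_cone e"
    and "ratio e (b + s *\<^sub>R x) \<le> ratio e b - s * curvature e b x / (1 + s * ratio x b)"
proof -
  have hb: "h b \<noteq> 0"
    using open_cone_nonzero[OF b] .
  define y where "y \<eta> = x + \<eta> *\<^sub>R e" for \<eta>
  have y_cone: "y \<eta> \<in> open_cone e" if "0 < \<eta>" for \<eta>
    unfolding y_def using closed_cone_add_open_cone[OF e x open_cone_scaleR[OF self_in_open_cone[OF e] that]] .
  have y_lim: "(y \<longlongrightarrow> x) (at_right 0)"
  proof -
    have "(y \<longlongrightarrow> x + 0 *\<^sub>R e) (at_right 0)"
      unfolding y_def by (intro tendsto_intros)
    then show ?thesis
      by simp
  qed
  have ratio_lim: "((\<lambda>\<eta>. ratio (y \<eta>) b) \<longlongrightarrow> ratio x b) (at_right 0)"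
    by (intro isCont_tendsto_compose[OF _ y_lim]
        linear_continuous_at linear_conv_bounded_linear[THEN iffD1] linear_ratio)
  have curv_lim: "((\<lambda>\<eta>. curvature e b (y \<eta>)) \<longlongrightarrow> curvature e b x) (at_right 0)"
    by (intro isCont_tendsto_compose[OF _ y_lim]
        linear_continuous_at linear_conv_bounded_linear[THEN iffD1] linear_curvature hb)
  have "((\<lambda>\<eta>. 1 + s * ratio (y \<eta>) b) \<longlongrightarrow> 1 + s * ratio x b) (at_right 0)"
    by (intro tendsto_intros ratio_lim)
  then have ev: "\<forall>\<^sub>F \<eta> in at_right 0. 0 < 1 + s * ratio (y \<eta>) b"
    using s by (rule order_tendstoD)
  show mem: "b + s *\<^sub>R x \<in> open_cone e"
  proof (cases "0 \<le> s")
    case True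
    show ?thesis
    proof (cases "s = 0")
      case False
      with True show ?thesis
        using closed_cone_add_open_cone[OF e closed_cone_scaleR[OF x] b] by (simp add: add.commute)
    qed (use b in simp)
  next
    case False
    from ev have "\<forall>\<^sub>F \<eta> in at_right 0. 0 < \<eta> \<and> 0 < 1 + s * ratio (y \<eta>) b"
      by (rule eventually_conj[OF eventually_at_right_less])
    then obtain \<eta> where \<eta>: "0 < \<eta>" "0 < 1 + s * ratio (y \<eta>) b"
      by (metis (mono_tags, lifting) eventually_happens trivial_limit_at_right_real)
    have "b + s *\<^sub>R y \<eta> \<in> open_cone e"
      by (rule barrier_step_open(1)[OF e b y_cone[OF \<eta>(1)] \<eta>(2)])
    \<comment> \<open>For negative s the perturbation errs on the safe side: \<open>b + s x\<close>
      exceeds \<open>b + s (y \<eta>)\<close> by the positive multiple \<open>- s \<eta>\<close> of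
      \<open>e\<close>.\<close>
    moreover have "(- s * \<eta>) *\<^sub>R e \<in> open_cone e"
      using False \<eta>(1) by (intro open_cone_scaleR self_in_open_cone e) (simp add: mult_neg_pos)
    ultimately have "b + s *\<^sub>R y \<eta> + (- s * \<eta>) *\<^sub>R e \<in> open_cone e"
      by (rule open_cone_add[OF e])
    then show ?thesis
      by (simp add: y_def algebra_simps)
  qed
  have "((\<lambda>\<eta>. b + s *\<^sub>R y \<eta>) \<longlongrightarrow> b + s *\<^sub>R x) (at_right 0)"
    by (intro tendsto_intros y_lim)
  then have lhs: "((\<lambda>\<eta>. ratio e (b + s *\<^sub>R y \<eta>)) \<longlongrightarrow> ratio e (b + s *\<^sub>R x)) (at_right 0)"
    by (rule isCont_tendsto_compose[OF isCont_ratio[OF open_cone_nonzero[OF mem]]])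
  have rhs: "((\<lambda>\<eta>. ratio e b - s * curvature e b (y \<eta>) / (1 + s * ratio (y \<eta>) b)) \<longlongrightarrow>
      ratio e b - s * curvature e b x / (1 + s * ratio x b)) (at_right 0)"
    using s by (intro tendsto_intros ratio_lim curv_lim) auto
  have "\<forall>\<^sub>F \<eta> in at_right 0. ratio e (b + s *\<^sub>R y \<eta>) \<le> ratio e b - s * curvature e b (y \<eta>) / (1 + s * ratio (y \<eta>) b)"
    using ev eventually_at_right_less
    by eventually_elim (rule barrier_step_open(2)[OF e b y_cone])
  with rhs lhs show "ratio e (b + s *\<^sub>R x) \<le> ratio e b - s * curvature e b x / (1 + s * ratio x b)"
    by (intro tendsto_le) auto
qed

text \<open>On the open cone both quantities are sums of nonnegative partial fraction terms.
  Linearity in the direction extends the sign to the closed cone through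
  \<open>x + \<eta> e\<close>.\<close>

lemma ratio_curvature_nonneg:
  assumes e: "hyperbolic_along e" and b: "b \<in> open_cone e" and x: "x \<in> closed_cone e"
  shows "0 \<le> ratio x b" and "0 \<le> curvature e b x"
proof -
  have pos: "0 \<le> ratio y b \<and> 0 \<le> curvature e b y" if "y \<in> open_cone e" for y
  proof -
    obtain a c :: "nat \<Rightarrow> real" where "\<And>i. i < d \<Longrightarrow> 0 < a i" "\<And>i. i < d \<Longrightarrow> 0 \<le> c i"
      "ratio y b = (\<Sum>i<d. 1 / a i)" "curvature e b y = (\<Sum>i<d. c i / (a i)\<^sup>2)"
      by (rule ratio_partial_fractions[OF e b \<open>y \<in> open_cone e\<close>]) (rule that)
    then show ?thesis
      by (auto intro!: sum_nonneg simp: less_imp_le)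
  qed
  have "0 \<le> f x" if f: "linear f" and nonneg: "\<And>y. y \<in> open_cone e \<Longrightarrow> 0 \<le> f y" for f :: "real^'n \<Rightarrow> real"
  proof -
    have "((\<lambda>\<eta>. f x + \<eta> * f e) \<longlongrightarrow> f x + 0 * f e) (at_right 0)"
      by (intro tendsto_intros)
    moreover have "\<forall>\<^sub>F \<eta> in at_right 0. 0 \<le> f x + \<eta> * f e"
      using eventually_at_right_less
    proof eventually_elim
      case (elim \<eta>)
      then show ?case
        using nonneg[OF closed_cone_add_open_cone[OF e x open_cone_scaleR[OF self_in_open_cone[OF e]]], of \<eta>] f
        by (simp add: linear_add linear_cmul)
    qed
    ultimately have "0 \<le> f x + 0 * f e"
      by (rule tendsto_lowerbound) simp
    then show ?thesis
      by simp
  qed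
  with pos linear_ratio linear_curvature[OF open_cone_nonzero[OF b]]
  show "0 \<le> ratio x b" "0 \<le> curvature e b x"
    by blast+
qed

end


section \<open>The barrier argument\<close>

text \<open>Here g0 and g1 are the upper barrier before and after a shift by \<delta>, and Q is the
  curvature after it in direction \<open>e\<close>. Termwise,
  \<open>1 / a i - 1 / (\<delta> + a i)\<close> is at least \<delta> times the square of
  \<open>1 / (\<delta> + a i)\<close>, so \<delta> Q is at most g0 - g1. The left side of the second
  inequality is the sum of all \<open>up i\<close> in \<open>potential_step\<close>.\<close>

lemma upper_shift_bound:
  fixes a :: "'i \<Rightarrow> real"
  assumes "finite I" "I \<noteq> {}" and a: "\<And>i. i \<in> I \<Longrightarrow> 0 < a i" and "0 < \<delta>"
  defines "g0 \<equiv> \<Sum>i\<in>I. 1 / a i" and "g1 \<equiv> \<Sum>i\<in>I. 1 / (\<delta> + a i)" and "Q \<equiv> \<Sum>i\<in>I. 1 / (\<delta> + a i)\<^sup>2"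
  shows "g1 < g0" and "g1 + Q / (g0 - g1) \<le> g0 + 1 / \<delta>"
proof -
  show less: "g1 < g0"
    unfolding g0_def g1_def using assms(1,2) a \<open>0 < \<delta>\<close>
    by (intro sum_strict_mono) (auto simp: frac_less2)
  have "\<delta> * Q \<le> g0 - g1"
    unfolding g0_def g1_def Q_def sum_distrib_left sum_subtractf[symmetric]
  proof (rule sum_mono)
    fix i assume "i \<in> I"
    then have "0 < a i"
      by (rule a)
    have "1 / a i - 1 / (\<delta> + a i) = \<delta> * (1 / (a i * (\<delta> + a i)))"
      using \<open>0 < a i\<close> \<open>0 < \<delta>\<close> by (simp add: divide_simps)
    also have "\<dots> \<ge> \<delta> * (1 / (\<delta> + a i)\<^sup>2)"
      using \<open>0 < a i\<close> \<open>0 < \<delta>\<close> unfolding power2_eq_square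
      by (intro mult_left_mono frac_le mult_right_mono) auto
    finally show "\<delta> * (1 / (\<delta> + a i)\<^sup>2) \<le> 1 / a i - 1 / (\<delta> + a i)" .
  qed
  then have "Q / (g0 - g1) \<le> 1 / \<delta>"
    using less \<open>0 < \<delta>\<close> by (simp add: field_simps)
  with less show "g1 + Q / (g0 - g1) \<le> g0 + 1 / \<delta>"
    by simp
qed

text \<open>The counterpart for the lower barrier, where the shift moves the spectrum towards 0.
  With X and Y as defined in the proof, g1 - g0 = \<delta> X and Q = X + \<delta> Y. Cauchy-Schwarz
  gives X^2 \<le> Y g0, and the bound on g0 turns this into \<delta> X^2 \<le> Y, so Q is at least
  (1/\<delta> + \<delta> X) \<delta> X.\<close>

lemma lower_shift_bound:
  fixes a :: "'i \<Rightarrow> real"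
  assumes "finite I" "I \<noteq> {}" and a: "\<And>i. i \<in> I \<Longrightarrow> \<delta> < a i" and "0 < \<delta>"
  defines "g0 \<equiv> \<Sum>i\<in>I. 1 / a i" and "g1 \<equiv> \<Sum>i\<in>I. 1 / (a i - \<delta>)" and "Q \<equiv> \<Sum>i\<in>I. 1 / (a i - \<delta>)\<^sup>2"
  assumes g0: "g0 \<le> 1 / \<delta>"
  shows "g0 < g1" and "1 / \<delta> - g0 \<le> Q / (g1 - g0) - g1"
proof -
  have pos: "0 < a i" "0 < a i - \<delta>" if "i \<in> I" for i
    using a[OF that] \<open>0 < \<delta>\<close> by auto
  show less: "g0 < g1"
    unfolding g0_def g1_def using assms(1,2) pos \<open>0 < \<delta>\<close>
    by (intro sum_strict_mono) (auto intro!: divide_strict_left_mono)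
  define X where "X = (\<Sum>i\<in>I. 1 / (a i * (a i - \<delta>)))"
  define Y where "Y = (\<Sum>i\<in>I. 1 / (a i * (a i - \<delta>)\<^sup>2))"
  have diff: "g1 - g0 = \<delta> * X"
    unfolding g0_def g1_def X_def sum_distrib_left sum_subtractf[symmetric]
    by (intro sum.cong refl) (use pos in \<open>force simp: divide_simps\<close>)
  have Q: "Q = X + \<delta> * Y"
    unfolding Q_def X_def Y_def sum_distrib_left sum.distrib[symmetric]
  proof (intro sum.cong refl)
    fix i assume "i \<in> I"
    then show "1 / (a i - \<delta>)\<^sup>2 = 1 / (a i * (a i - \<delta>)) + \<delta> * (1 / (a i * (a i - \<delta>)\<^sup>2))"
      using pos[of i] by (simp add: divide_simps power2_eq_square)
  qed
  have "0 < X"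
    using diff less \<open>0 < \<delta>\<close> by (metis diff_gt_0_iff_gt zero_less_mult_pos)
  have "0 \<le> Y"
    unfolding Y_def by (intro sum_nonneg) (use pos in \<open>auto simp: less_imp_le\<close>)
  have "X\<^sup>2 \<le> Y * g0"
  proof -
    have "X = (\<Sum>i\<in>I. (1 / (sqrt (a i) * (a i - \<delta>))) * (1 / sqrt (a i)))"
      unfolding X_def by (intro sum.cong refl) (use pos in \<open>force simp: field_simps\<close>)
    then have "X\<^sup>2 \<le> (\<Sum>i\<in>I. (1 / (sqrt (a i) * (a i - \<delta>)))\<^sup>2) * (\<Sum>i\<in>I. (1 / sqrt (a i))\<^sup>2)"
      using Cauchy_Schwarz_ineq_sum by metis
    also have "(\<Sum>i\<in>I. (1 / (sqrt (a i) * (a i - \<delta>)))\<^sup>2) = Y"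
      unfolding Y_def by (intro sum.cong refl) (use pos in \<open>auto simp: power_mult_distrib power_divide less_imp_le\<close>)
    also have "(\<Sum>i\<in>I. (1 / sqrt (a i))\<^sup>2) = g0"
      unfolding g0_def by (intro sum.cong refl) (use pos in \<open>auto simp: power_divide less_imp_le\<close>)
    finally show ?thesis .
  qed
  also have "\<dots> \<le> Y * (1 / \<delta>)"
    using g0 \<open>0 \<le> Y\<close> by (rule mult_left_mono)
  finally have "\<delta> * X\<^sup>2 \<le> Y"
    using \<open>0 < \<delta>\<close> by (simp add: field_simps)
  then have "(1 / \<delta> + (g1 - g0)) * (g1 - g0) \<le> Q"
    using \<open>0 < \<delta>\<close> unfolding diff Q by (simp add: field_simps power2_eq_square mult_left_mono)
  then have "1 / \<delta> + (g1 - g0) \<le> Q / (g1 - g0)"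
    using less by (simp add: pos_le_divide_eq)
  then show "1 / \<delta> - g0 \<le> Q / (g1 - g0) - g1"
    by simp
qed

context homogeneous_form
begin

section \<open>One step of the iteration and its repetition\<close>

lemma degree_pos: "0 < d"
  using K_line by (metis not_less_zero gr0I)

text \<open>In direction \<open>e\<close> itself all partial fraction coefficients are 1. So the
  effect of moving a barrier by a multiple of \<open>e\<close> is governed by the eigenvalues of
  \<open>b\<close> alone, as in the two shift bounds above.\<close>

lemma spectrum:
  assumes e: "hyperbolic_along e" and b: "b \<in> open_cone e"
  obtains a :: "nat \<Rightarrow> real"
  where "\<And>i. i < d \<Longrightarrow> 0 < a i"
    and "\<And>t. \<forall>i<d. 0 < t + a i \<Longrightarrow> b + t *\<^sub>R e \<in> open_cone e"
    and "\<And>t. \<forall>i<d. 0 < t + a i \<Longrightarrow> ratio e (b + t *\<^sub>R e) = (\<Sum>i<d. 1 / (t + a i))"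
    and "\<And>t. \<forall>i<d. 0 < t + a i \<Longrightarrow> curvature e (b + t *\<^sub>R e) e = (\<Sum>i<d. 1 / (t + a i)\<^sup>2)"
proof -
  obtain a :: "nat \<Rightarrow> real" where a: "\<And>t. h (b + t *\<^sub>R e) = h e * (\<Prod>i<d. t + a i)"
    using real_factorization[OF e, of b] by metis
  have he: "h e \<noteq> 0"
    using e by (simp add: hyperbolic_along_def)
  have pos: "0 < a i" if "i < d" for i
    using open_cone_roots_pos[OF b a that] .
  have mem: "b + t *\<^sub>R e \<in> open_cone e" if "\<forall>i<d. 0 < t + a i" for t
  proof -
    have "h (b + (t + r) *\<^sub>R e) \<noteq> 0" if "0 \<le> r" for r
      unfolding a using he \<open>\<forall>i<d. 0 < t + a i\<close> that by (force simp: add_nonneg_eq_0_iff)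
    then show ?thesis
      by (simp add: open_cone_def scaleR_left_distrib add.assoc)
  qed
  have shift: "h (b + t *\<^sub>R e + r *\<^sub>R e) = h e * (\<Prod>i<d. r + (t + a i))" for t r
    using a[of "t + r"] by (simp add: scaleR_left_distrib ac_simps)
  have ratio: "ratio e (b + t *\<^sub>R e) = (\<Sum>i<d. 1 / (t + a i))" if "\<forall>i<d. 0 < t + a i" for t
    by (rule ratio_eq_sum[OF shift open_cone_nonzero[OF mem[OF that]]])
  have "curvature e (b + t *\<^sub>R e) e = (\<Sum>i<d. 1 / (t + a i)\<^sup>2)" if t: "\<forall>i<d. 0 < t + a i" for t
  proof (rule curvature_eq_sum)
    have "\<forall>\<^sub>F r in nhds 0. \<forall>i<d. 0 < r + (t + a i)"
      by (rule eventually_roots_pos) (use t in auto)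
    then show "\<forall>\<^sub>F r in nhds 0. ratio e (b + t *\<^sub>R e + r *\<^sub>R e) = (\<Sum>i<d. 1 / (r + (t + a i)))"
    proof eventually_elim
      case (elim r)
      then show ?case
        using ratio[of "t + r"] by (simp add: scaleR_left_distrib ac_simps)
    qed
  qed (use t open_cone_nonzero[OF mem[OF t]] in auto)
  with pos mem ratio show thesis
    by (rule that)
qed

text \<open>For the determinant the two ratios are the traces of the inverses of
  \<open>u I - A\<close> and \<open>A - l I\<close>, the upper and lower potentials of Batson,
  Spielman and Srivastava.\<close>

definition potential_bound :: "real^'n \<Rightarrow> real \<Rightarrow> real \<Rightarrow> real^'n \<Rightarrow> real \<Rightarrow> real \<Rightarrow> bool" where
  "potential_bound e \<epsilon>\<^sub>u \<epsilon>\<^sub>l A u l \<longleftrightarrow>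
    u *\<^sub>R e - A \<in> open_cone e \<and> ratio e (u *\<^sub>R e - A) \<le> \<epsilon>\<^sub>u \<and>
    A - l *\<^sub>R e \<in> open_cone e \<and> ratio e (A - l *\<^sub>R e) \<le> \<epsilon>\<^sub>l"

text \<open>
  One step of the Batson--Spielman--Srivastava iteration. By averaging, some \<open>x i\<close> has
  \<open>up i < lo i\<close>; the step length is \<open>1 / lo i\<close>. The strict inequality in the hypothesis on the
  parameters keeps the upper constraint away from the boundary of the cone.
\<close>
lemma potential_step:
  assumes e: "hyperbolic_along e" and "finite I" and x: "\<And>i. i \<in> I \<Longrightarrow> x i \<in> closed_cone e"
    and sum: "(\<Sum>i\<in>I. x i) = e"
    and "0 < \<delta>\<^sub>u" "0 < \<delta>\<^sub>l" "\<epsilon>\<^sub>l < 1 / \<delta>\<^sub>l" and params: "1 / \<delta>\<^sub>u + \<epsilon>\<^sub>u < 1 / \<delta>\<^sub>l - \<epsilon>\<^sub>l"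
    and A: "potential_bound e \<epsilon>\<^sub>u \<epsilon>\<^sub>l A u l"
  obtains i t where "i \<in> I" "0 < t" "potential_bound e \<epsilon>\<^sub>u \<epsilon>\<^sub>l (A + t *\<^sub>R x i) (u + \<delta>\<^sub>u) (l + \<delta>\<^sub>l)"
proof -
  have Au: "u *\<^sub>R e - A \<in> open_cone e" "ratio e (u *\<^sub>R e - A) \<le> \<epsilon>\<^sub>u"
    and Al: "A - l *\<^sub>R e \<in> open_cone e" "ratio e (A - l *\<^sub>R e) \<le> \<epsilon>\<^sub>l"
    using A by (auto simp: potential_bound_def)
  have ratio_sum: "(\<Sum>i\<in>I. ratio (x i) b) = ratio e b" for b
    by (subst linear_sum[OF linear_ratio, symmetric]) (simp add: sum)
  have curv_sum: "(\<Sum>i\<in>I. curvature e b (x i)) = curvature e b e" if "h b \<noteq> 0" for b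
    by (subst linear_sum[OF linear_curvature[OF that], symmetric]) (simp add: sum)

  define B where "B = u *\<^sub>R e - A + \<delta>\<^sub>u *\<^sub>R e"
  define u0 where "u0 = ratio e (u *\<^sub>R e - A)"
  define u1 where "u1 = ratio e B"
  \<comment> \<open>By \<open>barrier_step\<close> with s = - t, the upper barrier returns to at
    most \<open>u0\<close> once \<open>t * curvature e B (x i) \<le> (u0 - u1) * (1 - t * ratio (x
    i) B)\<close>. Division by t and u0 - u1 turns this into
    \<open>up i \<le> 1 / t\<close>.\<close>
  define up where "up i = ratio (x i) B + curvature e B (x i) / (u0 - u1)" for i
  obtain a :: "nat \<Rightarrow> real" where a: "\<And>i. i < d \<Longrightarrow> 0 < a i"
    and a_mem: "\<And>t. \<forall>i<d. 0 < t + a i \<Longrightarrow> u *\<^sub>R e - A + t *\<^sub>R e \<in> open_cone e"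
    and a_ratio: "\<And>t. \<forall>i<d. 0 < t + a i \<Longrightarrow> ratio e (u *\<^sub>R e - A + t *\<^sub>R e) = (\<Sum>i<d. 1 / (t + a i))"
    and a_curv: "\<And>t. \<forall>i<d. 0 < t + a i \<Longrightarrow> curvature e (u *\<^sub>R e - A + t *\<^sub>R e) e = (\<Sum>i<d. 1 / (t + a i)\<^sup>2)"
    by (rule spectrum[OF e Au(1)]) (rule that)
  have a_shift: "\<forall>i<d. 0 < \<delta>\<^sub>u + a i"
    using a \<open>0 < \<delta>\<^sub>u\<close> by (simp add: add_pos_pos)
  have B: "B \<in> open_cone e"
    unfolding B_def by (rule a_mem[OF a_shift])
  have u0: "u0 = (\<Sum>i<d. 1 / a i)"
    unfolding u0_def using a_ratio[of 0] a by simp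
  have u1: "u1 = (\<Sum>i<d. 1 / (\<delta>\<^sub>u + a i))"
    unfolding u1_def B_def by (rule a_ratio[OF a_shift])
  have curv_B: "curvature e B e = (\<Sum>i<d. 1 / (\<delta>\<^sub>u + a i)\<^sup>2)"
    unfolding B_def by (rule a_curv[OF a_shift])
  have ne: "{..<d} \<noteq> {}"
    using degree_pos by auto
  note upper = upper_shift_bound[of "{..<d}" a \<delta>\<^sub>u, folded u0 u1 curv_B, OF finite_lessThan ne]
  have "u1 < u0" and up_le: "u1 + curvature e B e / (u0 - u1) \<le> u0 + 1 / \<delta>\<^sub>u"
    using upper a \<open>0 < \<delta>\<^sub>u\<close> by auto
  have up_nonneg: "0 \<le> curvature e B (x i) / (u0 - u1)" "0 \<le> ratio (x i) B" if "i \<in> I" for i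
    using ratio_curvature_nonneg[OF e B x[OF that]] \<open>u1 < u0\<close> by auto
  have "(\<Sum>i\<in>I. up i) = u1 + curvature e B e / (u0 - u1)"
    unfolding up_def sum.distrib sum_divide_distrib[symmetric]
    by (simp add: ratio_sum curv_sum[OF open_cone_nonzero[OF B]] u1_def)
  also have "\<dots> \<le> \<epsilon>\<^sub>u + 1 / \<delta>\<^sub>u"
    using up_le Au(2) by (simp add: u0_def)
  finally have sum_up: "(\<Sum>i\<in>I. up i) \<le> \<epsilon>\<^sub>u + 1 / \<delta>\<^sub>u" .

  define B' where "B' = A - l *\<^sub>R e + (- \<delta>\<^sub>l) *\<^sub>R e"
  define l0 where "l0 = ratio e (A - l *\<^sub>R e)"
  define l1 where "l1 = ratio e B'"
  \<comment> \<open>The same computation with s = t: the lower barrier returns to at most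
    \<open>l0\<close> once \<open>1 / t \<le> lo i\<close>.\<close>
  define lo where "lo i = curvature e B' (x i) / (l1 - l0) - ratio (x i) B'" for i
  obtain a' :: "nat \<Rightarrow> real" where a': "\<And>i. i < d \<Longrightarrow> 0 < a' i"
    and a'_mem: "\<And>t. \<forall>i<d. 0 < t + a' i \<Longrightarrow> A - l *\<^sub>R e + t *\<^sub>R e \<in> open_cone e"
    and a'_ratio: "\<And>t. \<forall>i<d. 0 < t + a' i \<Longrightarrow> ratio e (A - l *\<^sub>R e + t *\<^sub>R e) = (\<Sum>i<d. 1 / (t + a' i))"
    and a'_curv: "\<And>t. \<forall>i<d. 0 < t + a' i \<Longrightarrow> curvature e (A - l *\<^sub>R e + t *\<^sub>R e) e = (\<Sum>i<d. 1 / (t + a' i)\<^sup>2)"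
    by (rule spectrum[OF e Al(1)]) (rule that)
  have l0: "l0 = (\<Sum>i<d. 1 / a' i)"
    unfolding l0_def using a'_ratio[of 0] a' by simp
  \<comment> \<open>Each reciprocal is bounded by the barrier, which is below
    \<open>1 / \<delta>\<^sub>l\<close>. So the shift by \<open>\<delta>\<^sub>l\<close> does not
    leave the cone.\<close>
  have a'_gt: "\<delta>\<^sub>l < a' i" if "i < d" for i
  proof -
    have "1 / a' i \<le> l0"
      unfolding l0 by (rule member_le_sum) (use that a' in \<open>auto simp: less_imp_le\<close>)
    also have "\<dots> < 1 / \<delta>\<^sub>l"
      using Al(2) \<open>\<epsilon>\<^sub>l < 1 / \<delta>\<^sub>l\<close> by (simp add: l0_def)
    finally show ?thesis
      using a'[OF that] \<open>0 < \<delta>\<^sub>l\<close> by (simp add: field_simps)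
  qed
  then have a'_shift: "\<forall>i<d. 0 < - \<delta>\<^sub>l + a' i"
    by simp
  have B': "B' \<in> open_cone e"
    unfolding B'_def by (rule a'_mem[OF a'_shift])
  have l1: "l1 = (\<Sum>i<d. 1 / (a' i - \<delta>\<^sub>l))"
    unfolding l1_def B'_def using a'_ratio[OF a'_shift] by simp
  have curv_B': "curvature e B' e = (\<Sum>i<d. 1 / (a' i - \<delta>\<^sub>l)\<^sup>2)"
    unfolding B'_def using a'_curv[OF a'_shift] by simp
  have "l0 \<le> 1 / \<delta>\<^sub>l"
    using Al(2) \<open>\<epsilon>\<^sub>l < 1 / \<delta>\<^sub>l\<close> by (simp add: l0_def)
  note lower = lower_shift_bound[of "{..<d}" \<delta>\<^sub>l a', folded l0 l1 curv_B', OF finite_lessThan ne a'_gt \<open>0 < \<delta>\<^sub>l\<close> \<open>l0 \<le> 1 / \<delta>\<^sub>l\<close>]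
  have "l0 < l1" and lo_ge: "1 / \<delta>\<^sub>l - l0 \<le> curvature e B' e / (l1 - l0) - l1"
    using lower by auto
  have "1 / \<delta>\<^sub>l - \<epsilon>\<^sub>l \<le> curvature e B' e / (l1 - l0) - l1"
    using lo_ge Al(2) by (simp add: l0_def)
  also have "\<dots> = (\<Sum>i\<in>I. lo i)"
    unfolding lo_def sum_subtractf sum_divide_distrib[symmetric]
    by (simp add: ratio_sum curv_sum[OF open_cone_nonzero[OF B']] l1_def)
  finally have "(\<Sum>i\<in>I. up i) < (\<Sum>i\<in>I. lo i)"
    using sum_up params by simp
  then obtain i where i: "i \<in> I" "up i < lo i"
    by (meson not_le sum_mono)
  have "0 \<le> up i"
    using up_nonneg[OF i(1)] by (simp add: up_def)
  define t where "t = 1 / lo i"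
  have "0 < lo i"
    using i(2) \<open>0 \<le> up i\<close> by simp
  then have "0 < t" and lo_t: "lo i = 1 / t"
    by (simp_all add: t_def)

  have "ratio (x i) B < 1 / t"
    using i(2) up_nonneg[OF i(1)] by (simp add: up_def lo_t)
  then have s: "0 < 1 + (- t) * ratio (x i) B"
    using \<open>0 < t\<close> by (simp add: field_simps)
  have "curvature e B (x i) / (u0 - u1) \<le> 1 / t - ratio (x i) B"
    using i(2) by (simp add: up_def lo_t)
  then have "t * curvature e B (x i) \<le> (u0 - u1) * (1 - t * ratio (x i) B)"
    using \<open>u1 < u0\<close> \<open>0 < t\<close> by (simp add: field_simps)
  then have "t * curvature e B (x i) / (1 - t * ratio (x i) B) \<le> u0 - u1"
    using s by (simp add: pos_divide_le_eq)
  then have "ratio e (B + (- t) *\<^sub>R x i) \<le> u0"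
    using barrier_step(2)[OF e B x[OF i(1)] s] by (simp add: u1_def)
  moreover have "B + (- t) *\<^sub>R x i \<in> open_cone e"
    by (rule barrier_step(1)[OF e B x[OF i(1)] s])
  moreover have "B + (- t) *\<^sub>R x i = (u + \<delta>\<^sub>u) *\<^sub>R e - (A + t *\<^sub>R x i)"
    by (simp add: B_def algebra_simps)
  moreover have "0 \<le> ratio (x i) B'"
    using ratio_curvature_nonneg(1)[OF e B' x[OF i(1)]] .
  then have s': "0 < 1 + t * ratio (x i) B'"
    using \<open>0 < t\<close> by (simp add: add_pos_nonneg)
  have "curvature e B' (x i) / (l1 - l0) = 1 / t + ratio (x i) B'"
    using lo_t by (simp add: lo_def)
  then have "t * curvature e B' (x i) = (l1 - l0) * (1 + t * ratio (x i) B')"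
    using \<open>l0 < l1\<close> \<open>0 < t\<close> by (simp add: field_simps)
  then have "t * curvature e B' (x i) / (1 + t * ratio (x i) B') = l1 - l0"
    using s' by simp
  then have "ratio e (B' + t *\<^sub>R x i) \<le> l0"
    using barrier_step(2)[OF e B' x[OF i(1)] s'] by (simp add: l1_def)
  moreover have "B' + t *\<^sub>R x i \<in> open_cone e"
    by (rule barrier_step(1)[OF e B' x[OF i(1)] s'])
  moreover have "B' + t *\<^sub>R x i = A + t *\<^sub>R x i - (l + \<delta>\<^sub>l) *\<^sub>R e"
    by (simp add: B'_def algebra_simps)
  ultimately have "potential_bound e \<epsilon>\<^sub>u \<epsilon>\<^sub>l (A + t *\<^sub>R x i) (u + \<delta>\<^sub>u) (l + \<delta>\<^sub>l)"
    using Au(2) Al(2) unfolding potential_bound_def u0_def l0_def by (metis order.trans)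
  with i(1) \<open>0 < t\<close> show thesis
    by (rule that)
qed

lemma potential_iterate:
  assumes e: "hyperbolic_along e" and "finite I" and x: "\<And>i. i \<in> I \<Longrightarrow> x i \<in> closed_cone e"
    and sum: "(\<Sum>i\<in>I. x i) = e"
    and "0 < \<delta>\<^sub>u" "0 < \<delta>\<^sub>l" "\<epsilon>\<^sub>l < 1 / \<delta>\<^sub>l" and params: "1 / \<delta>\<^sub>u + \<epsilon>\<^sub>u < 1 / \<delta>\<^sub>l - \<epsilon>\<^sub>l"
    and start: "potential_bound e \<epsilon>\<^sub>u \<epsilon>\<^sub>l 0 u l"
  shows "\<exists>w. (\<forall>i\<in>I. 0 \<le> w i) \<and> card {i\<in>I. w i \<noteq> 0} \<le> N \<and>
    potential_bound e \<epsilon>\<^sub>u \<epsilon>\<^sub>l (\<Sum>i\<in>I. w i *\<^sub>R x i) (u + real N * \<delta>\<^sub>u) (l + real N * \<delta>\<^sub>l)"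
proof (induction N)
  case 0
  then show ?case
    using start by (intro exI[of _ "\<lambda>_. 0"]) simp
next
  case (Suc N)
  then obtain w where w: "\<forall>i\<in>I. 0 \<le> w i" "card {i\<in>I. w i \<noteq> 0} \<le> N"
    "potential_bound e \<epsilon>\<^sub>u \<epsilon>\<^sub>l (\<Sum>i\<in>I. w i *\<^sub>R x i) (u + real N * \<delta>\<^sub>u) (l + real N * \<delta>\<^sub>l)"
    by blast
  obtain i t where i: "i \<in> I" "0 < t"
    and step: "potential_bound e \<epsilon>\<^sub>u \<epsilon>\<^sub>l ((\<Sum>i\<in>I. w i *\<^sub>R x i) + t *\<^sub>R x i)
      (u + real N * \<delta>\<^sub>u + \<delta>\<^sub>u) (l + real N * \<delta>\<^sub>l + \<delta>\<^sub>l)"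
    by (rule potential_step[OF assms(1-8) w(3)])
  \<comment> \<open>The index \<open>i\<close> may have been chosen before, hence only an upper
    bound on the support.\<close>
  define w' where "w' = w(i := w i + t)"
  have "(\<Sum>j\<in>I. w' j *\<^sub>R x j) = (\<Sum>j\<in>I. w j *\<^sub>R x j + (if j = i then t *\<^sub>R x i else 0))"
    by (intro sum.cong refl) (auto simp: w'_def scaleR_left_distrib)
  also have "\<dots> = (\<Sum>j\<in>I. w j *\<^sub>R x j) + t *\<^sub>R x i"
    using \<open>finite I\<close> i(1) by (simp add: sum.distrib)
  finally have "potential_bound e \<epsilon>\<^sub>u \<epsilon>\<^sub>l (\<Sum>j\<in>I. w' j *\<^sub>R x j) (u + real (Suc N) * \<delta>\<^sub>u) (l + real (Suc N) * \<delta>\<^sub>l)"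
    using step by (simp add: algebra_simps)
  moreover have "card {j\<in>I. w' j \<noteq> 0} \<le> Suc N"
  proof -
    have "{j\<in>I. w' j \<noteq> 0} \<subseteq> insert i {j\<in>I. w j \<noteq> 0}"
      by (auto simp: w'_def split: if_splits)
    then have "card {j\<in>I. w' j \<noteq> 0} \<le> card (insert i {j\<in>I. w j \<noteq> 0})"
      using \<open>finite I\<close> by (intro card_mono) auto
    also have "\<dots> \<le> Suc (card {j\<in>I. w j \<noteq> 0})"
      by (rule card_insert_le_m1) auto
    finally show ?thesis
      using w(2) by simp
  qed
  moreover have "\<forall>j\<in>I. 0 \<le> w' j"
    using w(1) i by (auto simp: w'_def)
  ultimately show ?case
    by blast
qed

text \<open>
  The parameters are those of Batson, Spielman and Srivastava for \<open>s^2 = N / d\<close> steps per degree,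
  except for the factor \<open>\<kappa> > 1\<close>, which uses up the slack in the final ratio \<open>(s + 1)^2 / (s - 1)^2\<close>.
\<close>
lemma sparsify:
  assumes e: "hyperbolic_along e" and "finite I" and x: "\<And>i. i \<in> I \<Longrightarrow> x i \<in> closed_cone e"
    and sum: "(\<Sum>i\<in>I. x i) = e" and \<epsilon>: "0 < \<epsilon>" "\<epsilon> < 1"
    and N: "4 * d \<le> N" "4 * real d / \<epsilon>\<^sup>2 < real N + 1"
  shows "\<exists>w. (\<forall>i\<in>I. 0 \<le> w i) \<and> card {i\<in>I. w i \<noteq> 0} \<le> N \<and>
    (\<Sum>i\<in>I. w i *\<^sub>R x i) - (1 - \<epsilon>) *\<^sub>R e \<in> closed_cone e \<and>
    (1 + \<epsilon>) *\<^sub>R e - (\<Sum>i\<in>I. w i *\<^sub>R x i) \<in> closed_cone e"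
proof -
  define s where "s = sqrt (real N / real d)"
  have d: "1 \<le> real d"
    using degree_pos by simp
  have s2: "s\<^sup>2 = real N / real d"
    using d by (simp add: s_def)
  have "4 \<le> s\<^sup>2"
    unfolding s2 using N(1) d by (simp add: pos_le_divide_eq)
  then have s: "2 \<le> s"
    using d by (simp add: s_def real_le_rsqrt)
  have N_eq: "real N = real d * s\<^sup>2"
    using d by (simp add: s2)
  \<comment> \<open>The bound with N + 1 is what rounding down gives. Dividing by d leaves an error
    of 1/d, which is at most 1, and s^2 + 1 is also what the target inequality
    \<open>2 s < \<epsilon> (s^2 + 1)\<close> contains.\<close>
  have "4 / \<epsilon>\<^sup>2 < s\<^sup>2 + 1 / real d"
    using N(2) d unfolding N_eq by (simp add: field_simps)
  also have "\<dots> \<le> s\<^sup>2 + 1"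
    using d by simp
  finally have "4 < \<epsilon>\<^sup>2 * (s\<^sup>2 + 1)"
    using \<epsilon> by (simp add: field_simps)
  have "(2 * s)\<^sup>2 < 4 * (s\<^sup>2 + 1)"
    by (simp add: power_mult_distrib)
  also have "\<dots> < (\<epsilon>\<^sup>2 * (s\<^sup>2 + 1)) * (s\<^sup>2 + 1)"
    using \<open>4 < \<epsilon>\<^sup>2 * (s\<^sup>2 + 1)\<close> by (intro mult_strict_right_mono) (auto intro: add_nonneg_pos)
  also have "\<dots> = (\<epsilon> * (s\<^sup>2 + 1))\<^sup>2"
    by (simp add: power_mult_distrib power2_eq_square)
  finally have slack: "2 * s < \<epsilon> * (s\<^sup>2 + 1)"
    by (rule power_less_imp_less_base) (use \<epsilon> in simp)
  \<comment> \<open>Chosen so that \<kappa> (s + 1)^2 / (s - 1)^2, the ratio of the final barriers,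
    is exactly \<open>(1 + \<epsilon>) / (1 - \<epsilon>)\<close>. Then 1 < \<kappa> is a
    restatement of \<open>slack\<close>.\<close>
  define \<kappa> where "\<kappa> = (1 + \<epsilon>) / (1 - \<epsilon>) * ((s - 1)\<^sup>2 / (s + 1)\<^sup>2)"
  have "1 < \<kappa>"
  proof -
    have "(1 - \<epsilon>) * (s + 1)\<^sup>2 < (1 + \<epsilon>) * (s - 1)\<^sup>2"
      using slack by (simp add: power2_eq_square algebra_simps)
    then show ?thesis
      using \<epsilon> s by (simp add: \<kappa>_def field_simps)
  qed
  \<comment> \<open>\<delta> is the upper shift, against a lower shift of 1. Both \<delta> and the
    initial \<open>u\<close> carry the factor \<kappa>.\<close>
  define \<delta> where "\<delta> = \<kappa> * (s + 1) / (s - 1)"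
  define u where "u = \<kappa> * real d * s * (s + 1) / (s - 1)"
  have "0 < u" "0 < \<delta>"
    using s d \<open>1 < \<kappa>\<close> by (simp_all add: u_def \<delta>_def)
  have ratio_e: "ratio e (c *\<^sub>R e) = real d / c" if "0 < c" for c
  proof -
    have "h (c *\<^sub>R e + r *\<^sub>R e) = h e * (\<Prod>i<d. r + c)" for r
      by (simp add: h_scaleR add.commute flip: scaleR_left_distrib)
    then have "ratio e (c *\<^sub>R e) = (\<Sum>i<d. 1 / c)"
      by (rule ratio_eq_sum) (use e that in \<open>simp add: h_scaleR hyperbolic_along_def\<close>)
    then show ?thesis
      by simp
  qed
  note mem_e = open_cone_scaleR[OF self_in_open_cone[OF e]]
  \<comment> \<open>At A = 0 the barriers are \<open>ratio e (u e) = d / u\<close> and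
    \<open>ratio e (d s e) = 1 / s\<close>, so both bounds hold with equality.\<close>
  have start: "potential_bound e (real d / u) (1 / s) 0 u (- real d * s)"
    using mem_e[of u] mem_e[of "real d * s"] ratio_e[of u] ratio_e[of "real d * s"] \<open>0 < u\<close> s d
    by (simp add: potential_bound_def)
  \<comment> \<open>With \<kappa> = 1 this would be equal to 1 - 1/s. The strict inequality that
    \<open>potential_step\<close> asks for comes from 1 < \<kappa>.\<close>
  have "1 / \<delta> + real d / u = (1 / \<kappa>) * ((s - 1) / s)"
    using s d \<open>1 < \<kappa>\<close> by (simp add: \<delta>_def u_def divide_simps) (simp add: algebra_simps)
  also have "\<dots> < 1 * ((s - 1) / s)"
    using s \<open>1 < \<kappa>\<close> by (intro mult_strict_right_mono) auto
  also have "\<dots> = 1 / 1 - 1 / s"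
    using s by (simp add: field_simps)
  finally have params: "1 / \<delta> + real d / u < 1 / 1 - 1 / s" .
  have "1 / s < 1 / (1::real)"
    using s by simp
  from potential_iterate[OF e \<open>finite I\<close> x sum \<open>0 < \<delta>\<close> zero_less_one this params start, of N]
  obtain w where w: "\<forall>i\<in>I. 0 \<le> w i" "card {i\<in>I. w i \<noteq> 0} \<le> N"
    and final: "potential_bound e (real d / u) (1 / s) (\<Sum>i\<in>I. w i *\<^sub>R x i)
      (u + real N * \<delta>) (- real d * s + real N * 1)"
    by auto
  define L where "L = real d * s * (s - 1)"
  have "0 < L"
    using s d by (simp add: L_def)
  have L_eq: "- real d * s + real N * 1 = L"
    by (simp add: L_def N_eq power2_eq_square algebra_simps)
  have "u + real N * \<delta> = \<kappa> * (real d * s * (s + 1)\<^sup>2 / (s - 1))"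
    by (simp add: u_def N_eq \<delta>_def power2_eq_square algebra_simps flip: add_divide_distrib)
  also have "\<dots> = (1 + \<epsilon>) / (1 - \<epsilon>) * L"
    using s \<epsilon> by (simp add: \<kappa>_def L_def divide_simps power2_eq_square)
  finally have u_eq: "u + real N * \<delta> = (1 + \<epsilon>) / (1 - \<epsilon>) * L" .
  \<comment> \<open>Rescales the final lower barrier L to 1 - \<epsilon>, and thereby the upper one
    to 1 + \<epsilon>.\<close>
  define c where "c = (1 - \<epsilon>) / L"
  have "0 < c"
    using \<epsilon> \<open>0 < L\<close> by (simp add: c_def)
  define A where "A = (\<Sum>i\<in>I. w i *\<^sub>R x i)"
  have "A - L *\<^sub>R e \<in> open_cone e" "((1 + \<epsilon>) / (1 - \<epsilon>) * L) *\<^sub>R e - A \<in> open_cone e"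
    using final unfolding potential_bound_def L_eq u_eq A_def by auto
  from this[THEN open_cone_scaleR, OF \<open>0 < c\<close>]
  have "c *\<^sub>R A - (c * L) *\<^sub>R e \<in> open_cone e" "(c * ((1 + \<epsilon>) / (1 - \<epsilon>) * L)) *\<^sub>R e - c *\<^sub>R A \<in> open_cone e"
    by (simp_all add: scaleR_diff_right)
  moreover have "c * L = 1 - \<epsilon>" "c * ((1 + \<epsilon>) / (1 - \<epsilon>) * L) = 1 + \<epsilon>"
    using \<epsilon> \<open>0 < L\<close> by (simp_all add: c_def)
  ultimately have "c *\<^sub>R A - (1 - \<epsilon>) *\<^sub>R e \<in> closed_cone e" "(1 + \<epsilon>) *\<^sub>R e - c *\<^sub>R A \<in> closed_cone e"
    using open_subset_closed_cone by auto
  moreover have "c *\<^sub>R A = (\<Sum>i\<in>I. (c * w i) *\<^sub>R x i)"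
    by (simp add: A_def scaleR_sum_right)
  ultimately show ?thesis
    using w \<open>0 < c\<close> by (intro exI[of _ "\<lambda>i. c * w i"]) simp
qed

end


section \<open>Polynomials in several variables\<close>

text \<open>The derivative of \<open>mpoly_eval\<close> at \<open>z\<close> in direction
  \<open>w\<close>, by the product rule in each monomial. For exponent 0 the truncated
  \<open>lookup m i - 1\<close> is harmless because the factor \<open>of_nat 0\<close> kills the
  term. The target ring is left general so that the formula can also be evaluated in univariate
  polynomials.\<close>

definition mpoly_deriv ::
    "('a::zero \<Rightarrow> 'b::comm_ring_1) \<Rightarrow> ('n::finite, 'a) mpolynomial \<Rightarrow> ('n \<Rightarrow> 'b) \<Rightarrow> ('n \<Rightarrow> 'b) \<Rightarrow> 'b" where
  "mpoly_deriv \<phi> p w z =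
     (\<Sum>m\<in>Poly_Mapping.keys p. \<phi> (Poly_Mapping.lookup p m) *
       (\<Sum>i\<in>UNIV. of_nat (Poly_Mapping.lookup m i) * w i *
         (z i ^ (Poly_Mapping.lookup m i - 1) * (\<Prod>j\<in>UNIV-{i}. z j ^ Poly_Mapping.lookup m j))))"

lemma mpoly_eval_scale:
  assumes "homogeneous_of_degree d p"
  shows "mpoly_eval \<phi> p (\<lambda>i. c * z i) = c ^ d * mpoly_eval \<phi> p z"
  unfolding mpoly_eval_def sum_distrib_left
  by (intro sum.cong refl)
     (use assms in \<open>auto simp: homogeneous_of_degree_def power_mult_distrib prod.distrib simp flip: power_sum\<close>)

lemma poly_mpoly_eval:
  "poly (mpoly_eval (\<lambda>a. [:\<phi> a:]) p V) t = mpoly_eval \<phi> p (\<lambda>i. poly (V i) t)"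
  by (simp add: mpoly_eval_def poly_sum poly_prod poly_power)

lemma degree_linear_power: "degree ([:a, b:] ^ n) \<le> n"
  using degree_power_le[of "[:a, b:]" n] degree_pCons_le[of a "[:b:]"] by (simp split: if_splits)

lemma degree_prod_linear_power: "degree (\<Prod>i\<in>A. [:a i, b i:] ^ n i) \<le> (\<Sum>i\<in>A. n i)"
proof (cases "finite A")
  case True
  have "degree (\<Prod>i\<in>A. [:a i, b i:] ^ n i) \<le> (\<Sum>i\<in>A. degree ([:a i, b i:] ^ n i))"
    using degree_prod_sum_le[OF True] by (simp add: o_def)
  also have "\<dots> \<le> (\<Sum>i\<in>A. n i)"
    by (intro sum_mono degree_linear_power)
  finally show ?thesis .
qed simp

lemma degree_mpoly_eval_line:
  assumes "homogeneous_of_degree d p"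
  shows "degree (mpoly_eval (\<lambda>a. [:\<phi> a:]) p (\<lambda>i. [:z i, w i:])) \<le> d"
  unfolding mpoly_eval_def
proof (intro degree_sum_le order.trans[OF degree_mult_le])
  fix m assume "m \<in> Poly_Mapping.keys p"
  then have "(\<Sum>i\<in>UNIV. Poly_Mapping.lookup m i) = d"
    using assms by (simp add: homogeneous_of_degree_def)
  then show "degree [:\<phi> (Poly_Mapping.lookup p m):] + degree (\<Prod>i\<in>UNIV. [:z i, w i:] ^ Poly_Mapping.lookup m i) \<le> d"
    using degree_prod_linear_power[of z w "Poly_Mapping.lookup m" UNIV] by simp
qed simp

text \<open>The polynomial is the same formula evaluated at the linear polynomials of the line, with
  the direction entering as constants. Every nonzero term has lost one linear factor, which lowers
  the degree bound to d - 1.\<close>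

lemma mpoly_deriv_line:
  assumes p: "homogeneous_of_degree d p" and "0 < d"
  shows "\<exists>P. degree P < d \<and> (\<forall>t. mpoly_deriv \<phi> p v (\<lambda>i. z i + t * w i) = poly P t)"
proof -
  define P where "P = mpoly_deriv (\<lambda>a. [:\<phi> a:]) p (\<lambda>i. [:v i:]) (\<lambda>i. [:z i, w i:])"
  have "degree P \<le> d - 1"
    unfolding P_def mpoly_deriv_def
  proof (intro degree_sum_le order.trans[OF degree_mult_le])
    fix m assume "m \<in> Poly_Mapping.keys p"
    then have m: "(\<Sum>i\<in>UNIV. Poly_Mapping.lookup m i) = d"
      using p by (simp add: homogeneous_of_degree_def)
    have "degree (\<Sum>i\<in>UNIV. of_nat (Poly_Mapping.lookup m i) * [:v i:] *
         ([:z i, w i:] ^ (Poly_Mapping.lookup m i - 1) * (\<Prod>j\<in>UNIV-{i}. [:z j, w j:] ^ Poly_Mapping.lookup m j))) \<le> d - 1"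
    proof (rule degree_sum_le)
      fix i
      define Q where "Q = [:z i, w i:] ^ (Poly_Mapping.lookup m i - 1) * (\<Prod>j\<in>UNIV-{i}. [:z j, w j:] ^ Poly_Mapping.lookup m j)"
      have "of_nat (Poly_Mapping.lookup m i) * [:v i:] = [:of_nat (Poly_Mapping.lookup m i) * v i:]"
        by (simp add: of_nat_poly)
      then have eq: "of_nat (Poly_Mapping.lookup m i) * [:v i:] * Q = smult (of_nat (Poly_Mapping.lookup m i) * v i) Q"
        by (metis smult_0_left smult_conv_map_poly mult_pCons_left add_0_right pCons_0_0 mult_zero_left)
      show "degree (of_nat (Poly_Mapping.lookup m i) * [:v i:] *
         ([:z i, w i:] ^ (Poly_Mapping.lookup m i - 1) * (\<Prod>j\<in>UNIV-{i}. [:z j, w j:] ^ Poly_Mapping.lookup m j))) \<le> d - 1"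
      proof (cases "Poly_Mapping.lookup m i = 0")
        case False
        have "degree Q \<le> (Poly_Mapping.lookup m i - 1) + (\<Sum>j\<in>UNIV-{i}. Poly_Mapping.lookup m j)"
          unfolding Q_def
          by (intro order.trans[OF degree_mult_le] add_mono degree_linear_power degree_prod_linear_power)
        also have "\<dots> = d - 1"
          using False m sum.remove[of UNIV i "Poly_Mapping.lookup m"] by simp
        finally show ?thesis
          unfolding Q_def[symmetric] eq by (rule order.trans[OF degree_smult_le])
      qed simp
    qed simp
    then show "degree [:\<phi> (Poly_Mapping.lookup p m):] + degree (\<Sum>i\<in>UNIV. of_nat (Poly_Mapping.lookup m i) * [:v i:] *
         ([:z i, w i:] ^ (Poly_Mapping.lookup m i - 1) * (\<Prod>j\<in>UNIV-{i}. [:z j, w j:] ^ Poly_Mapping.lookup m j))) \<le> d - 1"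
      by simp
  qed simp
  moreover have "mpoly_deriv \<phi> p v (\<lambda>i. z i + t * w i) = poly P t" for t
    by (simp add: P_def mpoly_deriv_def poly_sum poly_prod poly_power mult_ac)
  ultimately show ?thesis
    using \<open>0 < d\<close> by (intro exI[of _ P]) auto
qed

lemma mpoly_eval_derivative:
  fixes z w :: "'n::finite \<Rightarrow> 'b::real_normed_field"
  shows "((\<lambda>r. mpoly_eval \<phi> p (\<lambda>i. z i + r * w i)) has_field_derivative mpoly_deriv \<phi> p w z) (at 0)"
proof -
  have "((\<lambda>r. (z i + r * w i) ^ n) has_field_derivative of_nat n * w i * z i ^ (n - 1)) (at 0)" for i n
    by (auto intro!: derivative_eq_intros)
  then have "((\<lambda>r. \<Prod>i\<in>UNIV. (z i + r * w i) ^ n i) has_field_derivative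
      (\<Sum>i\<in>UNIV. of_nat (n i) * w i * z i ^ (n i - 1) * (\<Prod>j\<in>UNIV-{i}. (z j + 0 * w j) ^ n j))) (at 0)" for n
    by (rule has_field_derivative_prod)
  then show ?thesis
    unfolding mpoly_eval_def mpoly_deriv_def
    by (intro DERIV_sum DERIV_cmult) (simp add: mult.assoc)
qed

lemma form_mpolynomial:
  fixes p :: "('n::finite, real) mpolynomial"
  assumes p: "homogeneous_of_degree d p" and "0 < d"
  shows "homogeneous_form (\<lambda>z. mpoly_eval complex_of_real p (\<lambda>i. z $ i)) (\<lambda>x. mpoly_eval (\<lambda>a. a) p (\<lambda>i. x $ i))
    (\<lambda>w z. mpoly_deriv complex_of_real p (\<lambda>i. complex_of_real (w $ i)) (\<lambda>i. z $ i))
    (\<lambda>w x. mpoly_deriv (\<lambda>a. a) p (\<lambda>i. w $ i) (\<lambda>i. x $ i)) d"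
proof
  fix z w :: "complex^'n" and x v :: "real^'n" and c :: complex
  show "mpoly_eval complex_of_real p (\<lambda>i. (c *s z) $ i) = c ^ d * mpoly_eval complex_of_real p (\<lambda>i. z $ i)"
    using mpoly_eval_scale[OF p] by simp
  show "\<exists>P. degree P \<le> d \<and> (\<forall>t. mpoly_eval complex_of_real p (\<lambda>i. (z + t *s w) $ i) = poly P t)"
    by (intro exI[of _ "mpoly_eval (\<lambda>a. [:complex_of_real a:]) p (\<lambda>i. [:z $ i, w $ i:])"])
       (simp add: degree_mpoly_eval_line[OF p] poly_mpoly_eval)
  show "continuous_on UNIV (\<lambda>z::complex^'n. mpoly_eval complex_of_real p (\<lambda>i. z $ i))"
    unfolding mpoly_eval_def by (intro continuous_intros)
  show "mpoly_eval complex_of_real p (\<lambda>i. cvec x $ i) = complex_of_real (mpoly_eval (\<lambda>a. a) p (\<lambda>i. x $ i))"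
    by (simp add: mpoly_eval_def)
  have coord: "real_polynomial_function (\<lambda>x::real^'n. x $ i)" for i
    by (rule real_polynomial_function.intros(1)) (rule bounded_linear_vec_nth)
  show "(\<lambda>x::real^'n. mpoly_eval (\<lambda>a. a) p (\<lambda>i. x $ i)) differentiable (at x)"
    unfolding mpoly_eval_def
    by (intro differentiable_at_real_polynomial_function real_polynomial_function_sum finite_keys
        real_polynomial_function.intros(2,4) real_polynomial_function_prod
        real_polynomial_function_power coord finite)
  show "((\<lambda>r. mpoly_eval complex_of_real p (\<lambda>i. (z + r *s cvec v) $ i)) has_field_derivative
      mpoly_deriv complex_of_real p (\<lambda>i. complex_of_real (v $ i)) (\<lambda>i. z $ i)) (at 0)"
    using mpoly_eval_derivative[of complex_of_real p "\<lambda>i. z $ i" "\<lambda>i. complex_of_real (v $ i)"] by simp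
  show "\<exists>P. degree P < d \<and> (\<forall>t. mpoly_deriv complex_of_real p (\<lambda>i. complex_of_real (v $ i)) (\<lambda>i. (z + t *s w) $ i) = poly P t)"
    using mpoly_deriv_line[OF p \<open>0 < d\<close>, of complex_of_real "\<lambda>i. complex_of_real (v $ i)" "\<lambda>i. z $ i" "\<lambda>i. w $ i"] by simp
  show "mpoly_deriv complex_of_real p (\<lambda>i. complex_of_real (v $ i)) (\<lambda>i. cvec x $ i) =
      complex_of_real (mpoly_deriv (\<lambda>a. a) p (\<lambda>i. v $ i) (\<lambda>i. x $ i))"
    by (simp add: mpoly_deriv_def)
  show "(\<lambda>x::real^'n. mpoly_deriv (\<lambda>a. a) p (\<lambda>i. v $ i) (\<lambda>i. x $ i)) differentiable (at x)"
    unfolding mpoly_deriv_def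
    by (intro differentiable_at_real_polynomial_function real_polynomial_function_sum finite_keys
        real_polynomial_function.intros(2,4) real_polynomial_function_prod
        real_polynomial_function_power coord finite)
qed

section \<open>Hyperbolic eigenvalues and the closed cone\<close>

lemma (in homogeneous_form) closed_cone_iff_roots:
  assumes e: "hyperbolic_along e" and \<mu>: "\<And>t. h (- x + t *\<^sub>R e) = h e * (\<Prod>i<d. t + \<mu> i)"
  shows "x \<in> closed_cone e \<longleftrightarrow> (\<forall>i<d. \<mu> i \<le> 0)"
proof -
  have he: "h e \<noteq> 0"
    using e by (simp add: hyperbolic_along_def)
  have zero_iff: "h (x + t *\<^sub>R e) = 0 \<longleftrightarrow> (\<exists>i<d. \<mu> i = t)" for t
  proof -
    \<comment> \<open>The eigenvalues are read off from \<open>t e - x\<close>, whereas the cone is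
      defined by \<open>x + t e\<close>. Homogeneity with the factor -1 connects the two, and the
      sign (-1)^d does not affect the zeros.\<close>
    have "x + t *\<^sub>R e = (-1) *\<^sub>R (- x + (- t) *\<^sub>R e)"
      by simp
    then have "h (x + t *\<^sub>R e) = (-1) ^ d * (h e * (\<Prod>i<d. - t + \<mu> i))"
      unfolding \<mu>[symmetric] by (simp only: h_scaleR)
    then show ?thesis
      using he by auto
  qed
  have "x \<in> closed_cone e \<longleftrightarrow> (\<forall>t>0. \<not> (\<exists>i<d. \<mu> i = t))"
    by (simp only: closed_cone_def zero_iff mem_Collect_eq)
  then show ?thesis
    by (metis not_less)
qed

lemma hyperbolicity_cone_iff_roots:
  assumes "line_poly p e x = smult c (\<Prod>i<d. [:\<mu> i, 1:])" "c \<noteq> 0"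
  shows "x \<in> hyperbolicity_cone d p e \<longleftrightarrow> (\<forall>i<d. \<mu> i \<le> 0)"
proof -
  have "proots (line_poly p e x) = (\<Sum>i<d. {#- \<mu> i#})"
    using assms by (simp add: proots_prod)
  then have "proots (line_poly p e x) = image_mset (\<lambda>i. - \<mu> i) (mset_set {..<d})"
    by (simp add: sum_unfold_sum_mset)
  then have mset: "mset (hyp_eigenvalues p e x) = image_mset (\<lambda>i. - \<mu> i) (mset_set {..<d})"
    by (simp add: hyp_eigenvalues_def)
  \<comment> \<open>The list has exactly d entries, so no index in the definition of the cone
    reaches past its end, where \<open>!\<close> is unspecified.\<close>
  then have len: "length (hyp_eigenvalues p e x) = d"
    by (metis card_lessThan size_image_mset size_mset size_mset_set)
  have set: "set (hyp_eigenvalues p e x) = (\<lambda>i. - \<mu> i) ` {..<d}"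
    using arg_cong[OF mset, of set_mset] by simp
  have "{1..d} = Suc ` {..<d}"
    by (simp add: image_Suc_lessThan)
  then have "x \<in> hyperbolicity_cone d p e \<longleftrightarrow> (\<forall>j<d. 0 \<le> hyp_eigenvalues p e x ! j)"
    unfolding hyperbolicity_cone_def hyp_eigenvalue_def by auto
  also have "\<dots> \<longleftrightarrow> (\<forall>y\<in>set (hyp_eigenvalues p e x). 0 \<le> y)"
    by (auto simp: all_set_conv_all_nth len)
  also have "\<dots> \<longleftrightarrow> (\<forall>i<d. \<mu> i \<le> 0)"
    by (auto simp: set)
  finally show ?thesis .
qed

section \<open>The sparsification function of the hyperbolicity cone\<close>

lemma upper_semicontinuous_floor:
  fixes f :: "'a::topological_space \<Rightarrow> real"
  assumes "continuous_on A f"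
  shows "upper_semicontinuous_on A (\<lambda>x. real_of_int \<lfloor>f x\<rfloor>)"
  unfolding upper_semicontinuous_on_def
proof (intro ballI allI impI)
  fix x c assume "x \<in> A" and c: "real_of_int \<lfloor>f x\<rfloor> < c"
  then have "(f \<longlongrightarrow> f x) (at x within A)"
    using assms by (simp add: continuous_on_def)
  then have "\<forall>\<^sub>F y in at x within A. f y < real_of_int \<lfloor>f x\<rfloor> + 1"
    by (rule order_tendstoD) linarith
  then show "\<forall>\<^sub>F y in at x within A. real_of_int \<lfloor>f y\<rfloor> < c"
  proof eventually_elim
    case (elim y)
    then have "\<lfloor>f y\<rfloor> \<le> \<lfloor>f x\<rfloor>"
      by linarith
    then show ?case
      using c by linarith
  qed
qed

text \<open>
  The rounded-up bound \<open>\<lceil>4 d / \<epsilon>\<^sup>2\<rceil>\<close> is not upper semicontinuous in \<open>\<epsilon>\<close>, but the rounded-down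
  one is.
\<close>
lemma sparsification_function_floor:
  fixes K :: "'a::euclidean_space set"
  assumes sparse: "\<And>(m::nat) (x :: nat \<Rightarrow> 'a) \<epsilon>. (\<And>i. i \<in> {1..m} \<Longrightarrow> x i \<in> K) \<Longrightarrow>
      (\<Sum>i\<in>{1..m}. x i) \<in> rel_interior K \<Longrightarrow> 0 < \<epsilon> \<Longrightarrow> \<epsilon> < 1 \<Longrightarrow>
      \<exists>w. (\<forall>i\<in>{1..m}. 0 \<le> w i) \<and> card {i\<in>{1..m}. w i \<noteq> 0} \<le> nat \<lfloor>4 * real d / \<epsilon>\<^sup>2\<rfloor> \<and>
        (\<Sum>i\<in>{1..m}. w i *\<^sub>R x i) - (1 - \<epsilon>) *\<^sub>R (\<Sum>i\<in>{1..m}. x i) \<in> K \<and>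
        (1 + \<epsilon>) *\<^sub>R (\<Sum>i\<in>{1..m}. x i) - (\<Sum>i\<in>{1..m}. w i *\<^sub>R x i) \<in> K"
    and "span K = UNIV"
  shows "sparsification_function K (\<lambda>\<epsilon>. real_of_int \<lfloor>4 * real d / \<epsilon>\<^sup>2\<rfloor>)"
  unfolding sparsification_function_def
proof (intro conjI allI impI)
  show "antimono_on {0<..<1} (\<lambda>\<epsilon>. real_of_int \<lfloor>4 * real d / \<epsilon>\<^sup>2\<rfloor>)"
    by (intro monotone_onI) (auto intro!: floor_mono divide_left_mono power_mono mult_pos_pos)
  show "upper_semicontinuous_on {0<..<1} (\<lambda>\<epsilon>. real_of_int \<lfloor>4 * real d / \<epsilon>\<^sup>2\<rfloor>)"
    by (intro upper_semicontinuous_floor continuous_intros) auto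
next
  fix m :: nat and x :: "nat \<Rightarrow> 'a" and e :: 'a and \<epsilon> :: real
  assume H: "(\<forall>i\<in>{1..m}. x i \<in> K) \<and> (\<Sum>i\<in>{1..m}. x i) = e \<and> e \<in> rel_interior K \<and> 0 < \<epsilon> \<and> \<epsilon> < 1"
  then obtain w where w: "\<forall>i\<in>{1..m}. 0 \<le> w i" "card {i\<in>{1..m}. w i \<noteq> 0} \<le> nat \<lfloor>4 * real d / \<epsilon>\<^sup>2\<rfloor>"
    "(\<Sum>i\<in>{1..m}. w i *\<^sub>R x i) - (1 - \<epsilon>) *\<^sub>R e \<in> K" "(1 + \<epsilon>) *\<^sub>R e - (\<Sum>i\<in>{1..m}. w i *\<^sub>R x i) \<in> K"
    using sparse[of m x \<epsilon>] by auto
  \<comment> \<open>Sparsification asks for positive scalars, so the indices of weight 0 are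
    discarded.\<close>
  define S where "S = {i\<in>{1..m}. w i \<noteq> 0}"
  have sum: "(\<Sum>i\<in>S. w i *\<^sub>R x i) = (\<Sum>i\<in>{1..m}. w i *\<^sub>R x i)"
    unfolding S_def by (intro sum.mono_neutral_left) auto
  have "0 \<le> \<lfloor>4 * real d / \<epsilon>\<^sup>2\<rfloor>"
    by simp
  then have "real (card S) \<le> real_of_int \<lfloor>4 * real d / \<epsilon>\<^sup>2\<rfloor>"
    using w(2) unfolding S_def by linarith
  moreover have "\<forall>i\<in>S. 0 < w i"
    using w(1) by (auto simp: S_def less_le)
  ultimately show "\<exists>S l. S \<subseteq> {1..m} \<and> real (card S) \<le> real_of_int \<lfloor>4 * real d / \<epsilon>\<^sup>2\<rfloor> \<and> (\<forall>i\<in>S. l i > 0) \<and>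
      cone_le K ((1 - \<epsilon>) *\<^sub>R e) (\<Sum>i\<in>S. l i *\<^sub>R x i) \<and> cone_le K (\<Sum>i\<in>S. l i *\<^sub>R x i) ((1 + \<epsilon>) *\<^sub>R e)"
    using w(3,4) sum \<open>span K = UNIV\<close>
    by (intro exI[of _ S] exI[of _ w]) (auto simp: cone_le_def S_def)
qed

lemma sparsification_function_hyperbolicity_cone:
  fixes p :: "('n::finite, real) mpolynomial" and e :: "real^'n" and d :: nat
  assumes hyp: "hyperbolic d p e"
  shows "sparsification_function (hyperbolicity_cone d p e) (\<lambda>\<epsilon>. real_of_int \<lfloor>4 * real d / \<epsilon>\<^sup>2\<rfloor>)"
proof (cases "d = 0")
  \<comment> \<open>There are no eigenvalues to test, so the cone is the whole space and the empty
    selection suffices.\<close>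
  case True
  then have "hyperbolicity_cone d p e = UNIV"
    by (simp add: hyperbolicity_cone_def)
  then show ?thesis
    by (intro sparsification_function_floor exI[of _ "\<lambda>_. 0"]) auto
next
  case False
  have p: "homogeneous_of_degree d p"
    using hyp by (simp add: hyperbolic_def)
  interpret homogeneous_form "\<lambda>z. mpoly_eval complex_of_real p (\<lambda>i. z $ i)" "\<lambda>x. mpoly_eval (\<lambda>a. a) p (\<lambda>i. x $ i)"
    "\<lambda>w z. mpoly_deriv complex_of_real p (\<lambda>i. complex_of_real (w $ i)) (\<lambda>i. z $ i)"
    "\<lambda>w x. mpoly_deriv (\<lambda>a. a) p (\<lambda>i. w $ i) (\<lambda>i. x $ i)" d
    using form_mpolynomial[OF p] False by simp
  have e: "hyperbolic_along e"
    unfolding hyperbolic_along_def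
  proof (intro conjI allI impI)
    show "mpoly_eval (\<lambda>a. a) p (\<lambda>i. e $ i) \<noteq> 0"
      using hyp by (simp add: hyperbolic_def)
    fix x :: "real^'n" and t :: complex assume "Im t \<noteq> 0"
    then have "mpoly_eval complex_of_real p (\<lambda>i. t * complex_of_real (e $ i) - complex_of_real ((- x) $ i)) \<noteq> 0"
      using hyp unfolding hyperbolic_def by (metis complex_is_Real_iff)
    then show "mpoly_eval complex_of_real p (\<lambda>i. (cvec x + t *s cvec e) $ i) \<noteq> 0"
      by (simp add: add.commute)
  qed
  have cone: "hyperbolicity_cone d p e = closed_cone e"
  proof (intro set_eqI)
    fix x
    obtain \<mu> :: "nat \<Rightarrow> real" where
      \<mu>: "\<And>t. mpoly_eval (\<lambda>a. a) p (\<lambda>i. (- x + t *\<^sub>R e) $ i) = mpoly_eval (\<lambda>a. a) p (\<lambda>i. e $ i) * (\<Prod>i<d. t + \<mu> i)"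
      using real_factorization[OF e, of "- x"] by metis
    have "poly (line_poly p e x) t = poly (smult (mpoly_eval (\<lambda>a. a) p (\<lambda>i. e $ i)) (\<Prod>i<d. [:\<mu> i, 1:])) t" for t
      using \<mu>[of t] by (simp add: line_poly_def poly_mpoly_eval poly_prod add.commute)
    then have "line_poly p e x = smult (mpoly_eval (\<lambda>a. a) p (\<lambda>i. e $ i)) (\<Prod>i<d. [:\<mu> i, 1:])"
      unfolding poly_eq_poly_eq_iff[symmetric] by (rule ext)
    from hyperbolicity_cone_iff_roots[OF this] show "x \<in> hyperbolicity_cone d p e \<longleftrightarrow> x \<in> closed_cone e"
      using e closed_cone_iff_roots[OF e \<mu>] by (simp add: hyperbolic_along_def)
  qed
  have interior: "interior (closed_cone e) \<noteq> {}"
    using interior_maximal[OF open_subset_closed_cone open_open_cone[OF e]] self_in_open_cone[OF e] by blast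
  then have "span (closed_cone e) = UNIV"
    using affine_hull_nonempty_interior affine_hull_subset_span by blast
  show ?thesis
    unfolding cone
  proof (rule sparsification_function_floor)
    fix m :: nat and x :: "nat \<Rightarrow> real^'n" and \<epsilon> :: real
    assume x: "\<And>i. i \<in> {1..m} \<Longrightarrow> x i \<in> closed_cone e"
      and sum: "(\<Sum>i\<in>{1..m}. x i) \<in> rel_interior (closed_cone e)" and \<epsilon>: "0 < \<epsilon>" "\<epsilon> < 1"
    \<comment> \<open>The target of the sparsification is the sum \<open>f\<close>, which may differ
      from \<open>e\<close>. As a point of the open cone it is a direction of hyperbolicity with the
      same closed cone, so \<open>sparsify\<close> is applied with \<open>f\<close> as
      direction.\<close>
    define f where "f = (\<Sum>i\<in>{1..m}. x i)"
    have f: "f \<in> open_cone e"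
      using sum interior_closed_cone by (simp add: f_def rel_interior_nonempty_interior[OF interior])
    note f_cone = closed_cone_cong[OF e f]
    \<comment> \<open>Since 4 d is an integer below \<open>4 d / \<epsilon>^2\<close>, it stays
      below after rounding down.\<close>
    have "4 * real d \<le> 4 * real d / \<epsilon>\<^sup>2"
      using \<epsilon> by (simp add: pos_le_divide_eq mult_left_le power_le_one)
    then have "4 * d \<le> nat \<lfloor>4 * real d / \<epsilon>\<^sup>2\<rfloor>" "4 * real d / \<epsilon>\<^sup>2 < real (nat \<lfloor>4 * real d / \<epsilon>\<^sup>2\<rfloor>) + 1"
      by linarith+
    with sparsify[OF hyperbolic_along_open_cone[OF e f] finite_atLeastAtMost _ f_def[symmetric] \<epsilon>] x
    show "\<exists>w. (\<forall>i\<in>{1..m}. 0 \<le> w i) \<and> card {i\<in>{1..m}. w i \<noteq> 0} \<le> nat \<lfloor>4 * real d / \<epsilon>\<^sup>2\<rfloor> \<and>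
        (\<Sum>i\<in>{1..m}. w i *\<^sub>R x i) - (1 - \<epsilon>) *\<^sub>R (\<Sum>i\<in>{1..m}. x i) \<in> closed_cone e \<and>
        (1 + \<epsilon>) *\<^sub>R (\<Sum>i\<in>{1..m}. x i) - (\<Sum>i\<in>{1..m}. w i *\<^sub>R x i) \<in> closed_cone e"
      unfolding f_cone f_def[symmetric] by blast
  qed fact
qed

theorem corollary1p6:
  fixes p :: "('n::finite, real) mpolynomial" and e :: "real^'n" and d :: nat
  assumes "hyperbolic d p e"
  shows "\<forall>\<epsilon>\<in>{0<..<1}. sp (hyperbolicity_cone d p e) \<epsilon> \<le> ereal (real_of_int \<lceil>4 * real d / \<epsilon>\<^sup>2\<rceil>)"
proof
  fix \<epsilon> :: real
  have "sp (hyperbolicity_cone d p e) \<epsilon> \<le> ereal (real_of_int \<lfloor>4 * real d / \<epsilon>\<^sup>2\<rfloor>)"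
    unfolding sp_def using sparsification_function_hyperbolicity_cone[OF assms] by (intro INF_lower) simp
  also have "\<dots> \<le> ereal (real_of_int \<lceil>4 * real d / \<epsilon>\<^sup>2\<rceil>)"
    by (simp add: floor_le_ceiling)
  finally show "sp (hyperbolicity_cone d p e) \<epsilon> \<le> ereal (real_of_int \<lceil>4 * real d / \<epsilon>\<^sup>2\<rceil>)" .
qed

end
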